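(* Consider a two-armed Bernoulli bandit with means $0<\mu_2<\mu_1<1$. For every integer $T\ge1$, Thompson Sampling (with uniform priors) satisfies, almost surely, $$\mathrm{SliReg}(\mathrm{TS};T)=\mu_1-\mu_2 .$$
   Context: Two-armed Bernoulli bandit: at each time $t\ge1$ the policy picks an arm $A_t\in\{1,2\}$ (possibly with internal randomization) from the history $(A_1,R_1,\dots,A_{t-1},R_{t-1})$, then observes $R_t\in\{0,1\}$ which, given $A_t$, is Bernoulli with mean $\mu_{A_t}$, independent of the past and of the policy's internal randomness. $N_a(t):=\sum_{i=1}^{t-1}\mathbf 1(A_i=a)$ is the number of pulls of arm $a$ before time $t$ and $S_a(t):=\sum_{i=1}^{t-1}\mathbf 1(A_i=a)R_i$ the number of successes. Thompson Sampling (TS): at time $t$, sample (independently across arms given the history) $\theta_a(t)\sim\mathrm{Beta}(1+S_a(t),\,1+N_a(t)-S_a(t))$ for $a=1,2$ and pull $A_t\in\arg\max_a\theta_a(t)$. The sliding regret is the random variable $\mathrm{SliReg}(\pi;T):=\limsup_{t\to\infty}\left(T\mu_1-\sum_{i=1}^{T}\mu_{A_{t+i}}\right)$. *)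

theory Defs
  imports "HOL-Probability.Probability"
begin

definition beta_distr :: "real \<Rightarrow> real \<Rightarrow> real measure" where
  "beta_distr a b = density lborel
     (\<lambda>x. ennreal (indicator {0<..<1} x * (x powr (a - 1) * (1 - x) powr (b - 1) / Beta a b)))"

(* Arms are the numbers 1 and 2. Rounds are numbered from 1 on: the values at index 0 of the
   arm, reward and sample processes are never used. *)

definition pulls :: "(nat \<Rightarrow> 'w \<Rightarrow> nat) \<Rightarrow> nat \<Rightarrow> nat \<Rightarrow> 'w \<Rightarrow> nat" where
  "pulls A a t \<omega> = (\<Sum>i = 1..<t. if A i \<omega> = a then 1 else 0)"

definition successes :: "(nat \<Rightarrow> 'w \<Rightarrow> nat) \<Rightarrow> (nat \<Rightarrow> 'w \<Rightarrow> nat) \<Rightarrow> nat \<Rightarrow> nat \<Rightarrow> 'w \<Rightarrow> nat" where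
  "successes A R a t \<omega> = (\<Sum>i = 1..<t. if A i \<omega> = a then R i \<omega> else 0)"

definition history :: "(nat \<Rightarrow> 'w \<Rightarrow> nat) \<Rightarrow> (nat \<Rightarrow> 'w \<Rightarrow> nat) \<Rightarrow> nat \<Rightarrow> 'w \<Rightarrow> (nat \<times> nat) list" where
  "history A R t \<omega> = map (\<lambda>i. (A i \<omega>, R i \<omega>)) [1..<t]"

definition history_algebra ::
  "'w measure \<Rightarrow> (nat \<Rightarrow> 'w \<Rightarrow> nat) \<Rightarrow> (nat \<Rightarrow> 'w \<Rightarrow> nat) \<Rightarrow> nat \<Rightarrow> 'w measure" where
  "history_algebra M A R t = vimage_algebra (space M) (history A R t) (count_space UNIV)"

(* Everything that precedes the observation of the reward of round t: the history, the arm
   pulled in round t (hence also any tie-breaking), and the samples drawn in rounds 1, ..., t,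
   which are the internal randomness of the policy. *)
definition pre_reward_algebra ::
  "'w measure \<Rightarrow> (nat \<Rightarrow> 'w \<Rightarrow> nat) \<Rightarrow> (nat \<Rightarrow> 'w \<Rightarrow> nat) \<Rightarrow> (nat \<Rightarrow> nat \<Rightarrow> 'w \<Rightarrow> real) \<Rightarrow> nat \<Rightarrow> 'w measure"
  where
  "pre_reward_algebra M A R \<theta> t = vimage_algebra (space M)
     (\<lambda>\<omega>. (history A R t \<omega>, A t \<omega>, \<lambda>(i, a)\<in>{1..t} \<times> {1, 2}. \<theta> i a \<omega>))
     (count_space UNIV \<Otimes>\<^sub>M count_space UNIV \<Otimes>\<^sub>M (\<Pi>\<^sub>M ia\<in>{1..t} \<times> {1, 2}. borel))"

locale thompson_sampling = prob_space M
  for M :: "'w measure" +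
  fixes \<mu> :: "nat \<Rightarrow> real"
    and A :: "nat \<Rightarrow> 'w \<Rightarrow> nat"
    and R :: "nat \<Rightarrow> 'w \<Rightarrow> nat"
    and \<theta> :: "nat \<Rightarrow> nat \<Rightarrow> 'w \<Rightarrow> real"
  assumes arm_measurable: "t \<ge> 1 \<Longrightarrow> A t \<in> M \<rightarrow>\<^sub>M count_space UNIV"
    and reward_measurable: "t \<ge> 1 \<Longrightarrow> R t \<in> M \<rightarrow>\<^sub>M count_space UNIV"
    and sample_measurable: "t \<ge> 1 \<Longrightarrow> a \<in> {1, 2} \<Longrightarrow> \<theta> t a \<in> borel_measurable M"
    (* given the history, the samples of the two arms are independent and Beta distributed *)
    and sample_law: "t \<ge> 1 \<Longrightarrow> B1 \<in> sets borel \<Longrightarrow> B2 \<in> sets borel \<Longrightarrow>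
      AE \<omega> in M.
        real_cond_exp M (history_algebra M A R t)
          (indicator {\<omega> \<in> space M. \<theta> t 1 \<omega> \<in> B1 \<and> \<theta> t 2 \<omega> \<in> B2}) \<omega> =
        measure (beta_distr (1 + real (successes A R 1 t \<omega>))
          (1 + real (pulls A 1 t \<omega>) - real (successes A R 1 t \<omega>))) B1 *
        measure (beta_distr (1 + real (successes A R 2 t \<omega>))
          (1 + real (pulls A 2 t \<omega>) - real (successes A R 2 t \<omega>))) B2"
    (* ties may be broken in any way *)
    and arm_choice: "t \<ge> 1 \<Longrightarrow> \<omega> \<in> space M \<Longrightarrow>
      is_arg_max (\<lambda>a. \<theta> t a \<omega>) (\<lambda>a. a \<in> {1, 2}) (A t \<omega>)"
    and reward_binary: "t \<ge> 1 \<Longrightarrow> \<omega> \<in> space M \<Longrightarrow> R t \<omega> \<in> {0, 1}"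
    (* given the pulled arm, the reward is Bernoulli and independent of the past and of the
       internal randomness *)
    and reward_law: "t \<ge> 1 \<Longrightarrow>
      AE \<omega> in M.
        real_cond_exp M (pre_reward_algebra M A R \<theta> t)
          (indicator {\<omega> \<in> space M. R t \<omega> = 1}) \<omega> = \<mu> (A t \<omega>)"

(* The sequence is bounded, so its limsup in the extended reals is a real number. *)
definition sliding_regret :: "(nat \<Rightarrow> real) \<Rightarrow> (nat \<Rightarrow> 'w \<Rightarrow> nat) \<Rightarrow> nat \<Rightarrow> 'w \<Rightarrow> ereal" where
  "sliding_regret \<mu> A T \<omega> =
     limsup (\<lambda>t. ereal (real T * \<mu> 1 - (\<Sum>i = 1..T. \<mu> (A (t + i) \<omega>))))"

end

theory Submission
  imports Defs
begin

text \<open>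
  Conditionally on the history, arm 2 is pulled with probability at most \<open>u(N\<^sub>1) + u(N\<^sub>2)\<close>, where
  \<open>u\<close> decays geometrically, as soon as both empirical means are close to the true means. The latter
  holds eventually, because both arms are pulled infinitely often: an arm that is pulled only
  finitely often keeps a fixed posterior, which beats the concentrating posterior of the other arm
  with a probability bounded from below. No rate for \<open>N\<^sub>2\<close> is needed to exclude two pulls of arm 2
  at a fixed distance: their expected number is at most the expectation of \<open>u(N\<^sub>1) + u(N\<^sub>2)\<close> summed over
  the pulls of arm 2. The part with \<open>N\<^sub>2\<close> is at most the sum of \<open>u(n)\<close> over \<open>n\<close>, and so is the part
  with \<open>N\<^sub>1\<close>, because in good rounds arm 1 is at least as likely to be pulled as arm 2. By
  Borel-Cantelli the pulls of arm 2 recur forever, but any two of them are eventually more than \<open>T\<close> rounds apart.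
\<close>

section \<open>Posterior tails\<close>

text \<open>The obstacle is that nothing is summable over time. Arm 2 is pulled infinitely often, so
  the probabilities of its single pulls have an infinite sum, and a tail bound in
  \<open>N\<^sub>2\<close> at a given time becomes small only as fast as \<open>N\<^sub>2\<close>
  grows, which is hard to control from below. Pairs of pulls are therefore summed over their first
  pull: every pull of an arm uses up a new value of its counter, so a series in the counter bounds
  the sum, however far apart the pulls are. The first pull enters the estimate for the second one as
  a weight that is measurable in the history. The empirical means are likewise controlled along
  counter values and not along time. The margin \<epsilon> is a quarter of the gap. The midpoint of
  the two means then lies \<open>2 * \<epsilon>\<close> away from each; one \<epsilon> is spent on
  the distance from the true to the empirical mean, the other on the distance from the empirical
  mean to the posterior sample.\<close>

lemma prob_space_beta_distr:
  assumes "a > 0" "b > 0"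
  shows "prob_space (beta_distr a b)"
proof
  have pos: "Beta a b > 0"
    using assms by (simp add: Beta_def Gamma_real_pos)
  have "((\<lambda>x. x powr (a - 1) * (1 - x) powr (b - 1)) has_integral Beta a b) {0<..<1}"
    using has_integral_Beta_real[of a b] assms by (simp add: has_integral_Icc_iff_Ioo)
  then have "((\<lambda>x. x powr (a - 1) * (1 - x) powr (b - 1) / Beta a b) has_integral
      Beta a b / Beta a b) {0<..<1}"
    by (rule has_integral_divide)
  then have "ennreal (Beta a b / Beta a b) = (\<integral>\<^sup>+x. ennreal (x powr (a - 1) * (1 - x) powr (b - 1) / Beta a b *
      indicator {0<..<1} x) \<partial>lborel)"
    using pos by (subst nn_integral_has_integral_lebesgue[symmetric]) (auto simp: mult_ac)
  then have "(\<integral>\<^sup>+x. ennreal (indicator {0<..<1} x *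
      (x powr (a - 1) * (1 - x) powr (b - 1) / Beta a b)) \<partial>lborel) = 1"
    using pos by (simp add: mult_ac)
  then show "emeasure (beta_distr a b) (space (beta_distr a b)) = 1"
    unfolding beta_distr_def by (subst emeasure_density) (auto cong: nn_integral_cong)
qed

lemma sets_beta_distr [simp, measurable_cong]: "sets (beta_distr a b) = sets borel"
  by (simp add: beta_distr_def)

lemma space_beta_distr [simp]: "space (beta_distr a b) = UNIV"
  by (simp add: beta_distr_def)

text \<open>Bayes' rule for the uniform prior: at these integer parameters the Beta function is the
  reciprocal of \<open>(n + 1) * (n choose s)\<close>. Read for fixed \<open>x\<close> as a
  probability in \<open>s\<close>, the density becomes accessible to concentration bounds for the
  binomial distribution.\<close>

lemma beta_density_eq_binomial_pmf:
  fixes x :: real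
  assumes "s \<le> n" "0 < x" "x < 1"
  shows "x powr (1 + real s - 1) * (1 - x) powr (1 + real n - real s - 1) /
      Beta (1 + real s) (1 + real n - real s) = real (n + 1) * pmf (binomial_pmf n x) s"
proof -
  have n: "1 + real n - real s = 1 + real (n - s)"
    using assms by simp
  have "Beta (1 + real s) (1 + real (n - s)) = fact s * fact (n - s) / fact (n + 1)"
    using assms Gamma_fact[of s, where 'a = real] Gamma_fact[of "n - s", where 'a = real]
      Gamma_fact[of "n + 1", where 'a = real]
    by (simp add: Beta_def add_ac)
  moreover have "fact (n + 1) / (fact s * fact (n - s)) = real (n + 1) * real (n choose s)"
    using assms by (simp add: binomial_fact)
  ultimately have "inverse (Beta (1 + real s) (1 + real (n - s))) = real (n + 1) * real (n choose s)"
    by simp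
  then show ?thesis
    using assms unfolding n by (simp add: powr_realpow divide_inverse mult_ac del: of_nat_diff)
qed

text \<open>The atom \<open>s\<close> belongs to the tail event on its own side of \<open>x\<close>,
  and Hoeffding's inequality bounds that tail. The bound does not depend on \<open>x\<close>, so it
  can be applied to a density pointwise.\<close>

lemma pmf_binomial_le:
  assumes "0 \<le> x" "x \<le> 1" "\<epsilon> \<ge> 0" "n > 0" "\<epsilon> \<le> \<bar>x - real s / real n\<bar>"
  shows "pmf (binomial_pmf n x) s \<le> exp (- 2 * real n * \<epsilon>\<^sup>2)"
proof -
  interpret binomial_distribution n x
    by standard (use assms in auto)
  have le: "pmf (binomial_pmf n x) s \<le> measure_pmf.prob (binomial_pmf n x) X" if "s \<in> X" for X
    unfolding measure_pmf_single[symmetric] using that by (intro measure_pmf.finite_measure_mono) auto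
  consider "real s / real n \<ge> x + \<epsilon>" | "real s / real n \<le> x - \<epsilon>"
    using assms by linarith
  then show ?thesis
  proof cases
    case 1
    then show ?thesis
      using prob_ge'[OF \<open>n > 0\<close> \<open>\<epsilon> \<ge> 0\<close>] le[of "{k. x + \<epsilon> \<le> real k / real n}"] by auto
  next
    case 2
    then show ?thesis
      using prob_le'[OF \<open>n > 0\<close> \<open>\<epsilon> \<ge> 0\<close>] le[of "{k. real k / real n \<le> x - \<epsilon>}"] by auto
  qed
qed

text \<open>
  With \<open>n + 1\<close> times a binomial probability as the Beta density, Hoeffding's inequality bounds the
  posterior tail by \<open>(n + 1) exp (- 2 n \<epsilon>\<^sup>2)\<close>; the following larger bound has the advantage of being
  decreasing in \<open>n\<close>.
\<close>

definition beta_tail :: "real \<Rightarrow> nat \<Rightarrow> real" where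
  "beta_tail \<epsilon> n = exp (- \<epsilon>\<^sup>2) ^ n / \<epsilon>\<^sup>2"

lemma beta_tail_nonneg: "beta_tail \<epsilon> n \<ge> 0"
  by (simp add: beta_tail_def)

lemma beta_tail_antimono: "m \<le> n \<Longrightarrow> beta_tail \<epsilon> n \<le> beta_tail \<epsilon> m"
  by (auto simp: beta_tail_def intro!: divide_right_mono power_decreasing)

lemma summable_beta_tail: "\<epsilon> \<noteq> 0 \<Longrightarrow> summable (beta_tail \<epsilon>)"
  unfolding beta_tail_def by (intro summable_divide summable_geometric) auto

lemma measure_beta_distr_tail:
  assumes "s \<le> n" "0 < n" "0 < \<epsilon>" "\<epsilon> \<le> 1" "B \<in> sets borel"
    and B: "\<And>x. x \<in> B \<Longrightarrow> \<epsilon> \<le> \<bar>x - real s / real n\<bar>"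
  shows "measure (beta_distr (1 + real s) (1 + real n - real s)) B \<le> beta_tail \<epsilon> n"
proof -
  let ?C = "real (n + 1) * exp (- 2 * real n * \<epsilon>\<^sup>2)"
  have "emeasure (beta_distr (1 + real s) (1 + real n - real s)) B =
    (\<integral>\<^sup>+x. ennreal (indicator {0<..<1} x * (x powr (1 + real s - 1) *
      (1 - x) powr (1 + real n - real s - 1) / Beta (1 + real s) (1 + real n - real s))) *
      indicator B x \<partial>lborel)"
    unfolding beta_distr_def using assms by (intro emeasure_density) auto
  also have "\<dots> \<le> (\<integral>\<^sup>+x. ennreal ?C * indicator {0<..<1::real} x \<partial>lborel)"
  proof (intro nn_integral_mono)
    fix x :: real
    have "x powr (1 + real s - 1) * (1 - x) powr (1 + real n - real s - 1) /
      Beta (1 + real s) (1 + real n - real s) \<le> ?C" if "x \<in> {0<..<1}" "x \<in> B"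
    proof -
      have "pmf (binomial_pmf n x) s \<le> exp (- 2 * real n * \<epsilon>\<^sup>2)"
        using that assms by (intro pmf_binomial_le) auto
      then show ?thesis
        using that assms
        by (subst beta_density_eq_binomial_pmf) (auto intro!: mult_left_mono simp del: pmf_binomial)
    qed
    then show "ennreal (indicator {0<..<1} x * (x powr (1 + real s - 1) *
      (1 - x) powr (1 + real n - real s - 1) / Beta (1 + real s) (1 + real n - real s))) *
      indicator B x \<le> ennreal ?C * indicator {0<..<1} x"
      by (auto simp: indicator_def intro!: ennreal_leI)
  qed
  also have "\<dots> = ennreal ?C"
    by (simp add: nn_integral_cmult_indicator)
  finally have "measure (beta_distr (1 + real s) (1 + real n - real s)) B \<le> ?C"
    unfolding measure_def by (intro enn2real_leI) auto
  also have "?C = real (n + 1) * exp (- real n * \<epsilon>\<^sup>2) * exp (- real n * \<epsilon>\<^sup>2)"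
    by (simp add: exp_add[symmetric])
  \<comment> \<open>One of the two exponential factors absorbs \<open>n + 1\<close>: since
    \<open>\<epsilon> \<le> 1\<close>, the product \<open>(n + 1) * \<epsilon>\<^sup>2\<close> is at
    most \<open>1 + n * \<epsilon>\<^sup>2\<close>, hence at most
    \<open>exp (n * \<epsilon>\<^sup>2)\<close>.\<close>
  also have "\<dots> \<le> (1 / \<epsilon>\<^sup>2) * exp (- real n * \<epsilon>\<^sup>2)"
  proof (rule mult_right_mono)
    have "real (n + 1) * \<epsilon>\<^sup>2 \<le> 1 + real n * \<epsilon>\<^sup>2"
      using assms by (simp add: algebra_simps power_le_one)
    also have "\<dots> \<le> exp (real n * \<epsilon>\<^sup>2)"
      by (rule exp_ge_add_one_self)
    finally show "real (n + 1) * exp (- real n * \<epsilon>\<^sup>2) \<le> 1 / \<epsilon>\<^sup>2"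
      using assms by (simp add: exp_minus field_simps)
  qed auto
  also have "\<dots> = beta_tail \<epsilon> n"
    by (simp add: beta_tail_def exp_of_nat_mult[symmetric])
  finally show ?thesis .
qed

text \<open>The density is positive on \<open>{c<..<1}\<close>, an interval of positive length.
  Hence an arm with few observations, or none, keeps a chance of sampling above any level below
  1.\<close>

lemma measure_beta_distr_pos:
  assumes "s \<le> n" "0 \<le> c" "c < 1"
  shows "measure (beta_distr (1 + real s) (1 + real n - real s)) {c<..} > 0"
proof -
  interpret prob_space "beta_distr (1 + real s) (1 + real n - real s)"
    by (rule prob_space_beta_distr) (use assms in auto)
  define f where "f x = ennreal (indicator {0<..<1} x * (x powr (1 + real s - 1) *
      (1 - x) powr (1 + real n - real s - 1) / Beta (1 + real s) (1 + real n - real s)))" for x :: real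
  have [measurable]: "f \<in> borel_measurable borel"
    unfolding f_def by measurable
  have f: "f x > 0" if "c < x" "x < 1" for x
  proof -
    have "real (n + 1) * pmf (binomial_pmf n x) s > 0"
      using that assms by auto
    then show ?thesis
      using that assms unfolding f_def by (subst beta_density_eq_binomial_pmf) auto
  qed
  have "emeasure (beta_distr (1 + real s) (1 + real n - real s)) {c<..} \<noteq> 0"
  proof
    assume "emeasure (beta_distr (1 + real s) (1 + real n - real s)) {c<..} = 0"
    then have "(\<integral>\<^sup>+x. f x * indicator {c<..} x \<partial>lborel) = 0"
      unfolding beta_distr_def by (subst (asm) emeasure_density) (auto simp: f_def)
    then have "AE x in lborel. f x * indicator {c<..} x = 0"
      by (subst (asm) nn_integral_0_iff_AE) auto
    then have "AE x in lborel. x \<notin> {c<..<1}"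
    proof eventually_elim
      case (elim x)
      then show ?case using f[of x] by (auto simp: indicator_def split: if_splits)
    qed
    then have "emeasure lborel {c<..<1} = 0"
      by (subst (asm) AE_iff_measurable[of "{c<..<1}"]) auto
    then show False
      using assms by simp
  qed
  then show ?thesis
    by (simp add: emeasure_eq_measure zero_less_measure_iff)
qed

text \<open>Hoeffding's lemma for a centred Bernoulli variable, whose moment generating function is
  the left-hand side. Negative \<open>l\<close> reduces to positive \<open>l\<close> by exchanging
  the two outcomes, which replaces \<open>p\<close> by \<open>1 - p\<close>.\<close>

lemma bernoulli_mgf_le:
  fixes l p :: real
  assumes "0 \<le> p" "p \<le> 1"
  shows "(1 - p) * exp (l * (0 - p)) + p * exp (l * (1 - p)) \<le> exp (l\<^sup>2 / 8)"
proof -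
  have *: "(1 - p) * exp (l * (0 - p)) + p * exp (l * (1 - p)) \<le> exp (l\<^sup>2 / 8)"
    if "l \<ge> 0" "0 \<le> p" "p \<le> 1" for l p :: real
  proof -
    have pos: "1 + p * (exp l - 1) > 0"
      using that by (intro add_pos_nonneg) auto
    have "(1 - p) * exp (l * (0 - p)) + p * exp (l * (1 - p)) = exp (- l * p) * (1 + p * (exp l - 1))"
      by (simp add: algebra_simps exp_add[symmetric] exp_diff exp_minus field_simps)
    also have "\<dots> = exp (- l * p + ln (1 + p * (exp l - 1)))"
      using pos by (simp only: exp_add exp_ln)
    also have "\<dots> \<le> exp (l\<^sup>2 / 8)"
      using Hoeffdings_lemma_aux[of l p] that by simp
    finally show ?thesis .
  qed
  show ?thesis
  proof (cases "l \<ge> 0")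
    case True
    then show ?thesis using * assms by auto
  next
    case False
    then show ?thesis using *[of "- l" "1 - p"] assms by (simp add: algebra_simps)
  qed
qed

section \<open>Expectations under the sampling and reward laws\<close>

lemma pulls_1 [simp]: "pulls A a (Suc 0) \<omega> = 0"
  by (simp add: pulls_def)

lemma successes_1 [simp]: "successes A R a (Suc 0) \<omega> = 0"
  by (simp add: successes_def)

lemma pulls_Suc:
  "t \<ge> 1 \<Longrightarrow> pulls A a (Suc t) \<omega> = pulls A a t \<omega> + (if A t \<omega> = a then 1 else 0)"
  by (simp add: pulls_def)

lemma successes_Suc:
  "t \<ge> 1 \<Longrightarrow> successes A R a (Suc t) \<omega> = successes A R a t \<omega> + (if A t \<omega> = a then R t \<omega> else 0)"
  by (simp add: successes_def)

lemma pulls_mono: "s \<le> t \<Longrightarrow> pulls A a s \<omega> \<le> pulls A a t \<omega>"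
  unfolding pulls_def by (intro sum_mono2) auto

lemma (in prob_space) integrable_times_bounded:
  fixes f g :: "'a \<Rightarrow> real"
  assumes "f \<in> borel_measurable M" "g \<in> borel_measurable M"
    "\<And>\<omega>. \<omega> \<in> space M \<Longrightarrow> \<bar>f \<omega>\<bar> \<le> C" "\<And>\<omega>. \<omega> \<in> space M \<Longrightarrow> \<bar>g \<omega>\<bar> \<le> 1"
  shows "integrable M (\<lambda>\<omega>. f \<omega> * g \<omega>)"
proof (rule integrable_const_bound)
  show "AE \<omega> in M. norm (f \<omega> * g \<omega>) \<le> C"
  proof (rule AE_I2)
    fix \<omega> assume "\<omega> \<in> space M"
    then have "\<bar>f \<omega>\<bar> * \<bar>g \<omega>\<bar> \<le> C * 1"
      using assms(3)[of \<omega>] by (intro mult_mono assms) auto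
    then show "norm (f \<omega> * g \<omega>) \<le> C" by (simp add: abs_mult)
  qed
  show "(\<lambda>\<omega>. f \<omega> * g \<omega>) \<in> borel_measurable M"
    using assms(1,2) by (rule borel_measurable_times)
qed

context thompson_sampling
begin

lemma arm_cases: "t \<ge> 1 \<Longrightarrow> \<omega> \<in> space M \<Longrightarrow> A t \<omega> = 1 \<or> A t \<omega> = 2"
  using arm_choice[of t \<omega>] by (auto simp: is_arg_max_def)

lemma reward_le_1: "t \<ge> 1 \<Longrightarrow> \<omega> \<in> space M \<Longrightarrow> R t \<omega> \<le> 1"
  using reward_binary[of t \<omega>] by auto

lemma successes_le_pulls: "\<omega> \<in> space M \<Longrightarrow> successes A R a t \<omega> \<le> pulls A a t \<omega>"
  unfolding successes_def pulls_def by (intro sum_mono) (use reward_le_1 in auto)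

lemma pulls_add: "\<omega> \<in> space M \<Longrightarrow> pulls A 1 t \<omega> + pulls A 2 t \<omega> = t - 1"
proof -
  assume \<omega>: "\<omega> \<in> space M"
  have "pulls A 1 t \<omega> + pulls A 2 t \<omega> = (\<Sum>i = 1..<t. 1)"
    unfolding pulls_def sum.distrib[symmetric]
  proof (intro sum.cong refl)
    fix i assume "i \<in> {1..<t}"
    then show "(if A i \<omega> = 1 then 1 else 0) + (if A i \<omega> = 2 then 1 else 0) = (1::nat)"
      using arm_cases[of i \<omega>] \<omega> by auto
  qed
  then show ?thesis by simp
qed

section \<open>Measurability with respect to the history and to the information before a
  reward\<close>

abbreviation (input) hist :: "nat \<Rightarrow> 'w measure" where
  "hist t \<equiv> history_algebra M A R t"

abbreviation (input) pre :: "nat \<Rightarrow> 'w measure" where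
  "pre t \<equiv> pre_reward_algebra M A R \<theta> t"

text \<open>Histories form a countable type, so preimages of single lists suffice. Round
  \<open>i\<close> sits at list index \<open>i - 1\<close>, because rounds start at 1.\<close>

lemma history_measurable: "history A R t \<in> M \<rightarrow>\<^sub>M count_space UNIV"
proof -
  have "{\<omega> \<in> space M. history A R t \<omega> = h} \<in> sets M" for h
  proof -
    have "{\<omega> \<in> space M. history A R t \<omega> = h} = {\<omega> \<in> space M. length h = t - 1 \<and>
        (\<forall>i\<in>{1..<t}. A i \<omega> = fst (h ! (i - 1)) \<and> R i \<omega> = snd (h ! (i - 1)))}"
    proof (intro Collect_cong conj_cong refl)
      fix \<omega>
      have "history A R t \<omega> = h \<longleftrightarrow> length h = t - 1 \<and>
          (\<forall>i<t - 1. (A (Suc i) \<omega>, R (Suc i) \<omega>) = h ! i)"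
        by (auto simp: history_def list_eq_iff_nth_eq)
      also have "(\<forall>i<t - 1. (A (Suc i) \<omega>, R (Suc i) \<omega>) = h ! i) \<longleftrightarrow>
          (\<forall>i\<in>{1..<t}. (A i \<omega>, R i \<omega>) = h ! (i - 1))"
      proof safe
        fix i assume *: "\<forall>i<t - 1. (A (Suc i) \<omega>, R (Suc i) \<omega>) = h ! i" "i \<in> {1..<t}"
        then show "(A i \<omega>, R i \<omega>) = h ! (i - 1)"
          using *(1)[rule_format, of "i - 1"] by auto
      next
        fix i assume *: "\<forall>i\<in>{1..<t}. (A i \<omega>, R i \<omega>) = h ! (i - 1)" "i < t - 1"
        then show "(A (Suc i) \<omega>, R (Suc i) \<omega>) = h ! i"
          using *(1)[rule_format, of "Suc i"] by auto
      qed
      finally show "history A R t \<omega> = h \<longleftrightarrow> length h = t - 1 \<and>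
        (\<forall>i\<in>{1..<t}. A i \<omega> = fst (h ! (i - 1)) \<and> R i \<omega> = snd (h ! (i - 1)))"
        by (auto simp: prod_eq_iff)
    qed
    also have "\<dots> \<in> sets M"
      using arm_measurable reward_measurable by measurable
    finally show ?thesis .
  qed
  then show ?thesis
    by (subst measurable_count_space_eq2_countable) (auto simp: vimage_def Int_def conj_commute)
qed

lemma subalgebra_hist: "subalgebra M (hist t)"
  unfolding subalgebra_def history_algebra_def
  using sets_image_in_sets[OF refl history_measurable] by simp

lemma finite_measure_subalgebra_hist: "finite_measure_subalgebra M (hist t)"
  by standard (rule subalgebra_hist)

lemma measurable_hist: "f \<in> hist t \<rightarrow>\<^sub>M N \<Longrightarrow> f \<in> M \<rightarrow>\<^sub>M N"
  by (rule measurable_from_subalg[OF subalgebra_hist])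

lemma sets_hist: "X \<in> sets (hist t) \<Longrightarrow> X \<in> sets M"
  using subalgebra_hist unfolding subalgebra_def by auto

lemma space_hist [simp]: "space (hist t) = space M"
  by (simp add: history_algebra_def)

lemma history_measurable_hist: "history A R t \<in> hist t \<rightarrow>\<^sub>M count_space UNIV"
  unfolding history_algebra_def by (rule measurable_vimage_algebra1) auto

lemma arm_measurable_hist:
  assumes "1 \<le> i" "i < t" shows "A i \<in> hist t \<rightarrow>\<^sub>M count_space UNIV"
proof -
  have "(\<lambda>h. fst (h ! (i - 1))) \<circ> history A R t \<in> hist t \<rightarrow>\<^sub>M count_space UNIV"
    by (rule measurable_comp[OF history_measurable_hist]) simp
  also have "(\<lambda>h. fst (h ! (i - 1))) \<circ> history A R t = A i"
    using assms by (auto simp: history_def fun_eq_iff)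
  finally show ?thesis .
qed

lemma reward_measurable_hist:
  assumes "1 \<le> i" "i < t" shows "R i \<in> hist t \<rightarrow>\<^sub>M count_space UNIV"
proof -
  have "(\<lambda>h. snd (h ! (i - 1))) \<circ> history A R t \<in> hist t \<rightarrow>\<^sub>M count_space UNIV"
    by (rule measurable_comp[OF history_measurable_hist]) simp
  also have "(\<lambda>h. snd (h ! (i - 1))) \<circ> history A R t = R i"
    using assms by (auto simp: history_def fun_eq_iff)
  finally show ?thesis .
qed

lemma pulls_measurable_hist:
  assumes "s \<le> t" shows "pulls A a s \<in> hist t \<rightarrow>\<^sub>M count_space UNIV"
proof -
  have [measurable]: "A i \<in> hist t \<rightarrow>\<^sub>M count_space UNIV" if "i \<in> {1..<s}" for i
    using arm_measurable_hist[of i t] that assms by auto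
  show ?thesis
    unfolding pulls_def by measurable
qed

lemma successes_measurable_hist:
  assumes "s \<le> t" shows "successes A R a s \<in> hist t \<rightarrow>\<^sub>M count_space UNIV"
proof -
  have [measurable]: "A i \<in> hist t \<rightarrow>\<^sub>M count_space UNIV" "R i \<in> hist t \<rightarrow>\<^sub>M count_space UNIV"
    if "i \<in> {1..<s}" for i
    using arm_measurable_hist[of i t] reward_measurable_hist[of i t] that assms by auto
  show ?thesis
    unfolding successes_def by measurable
qed

lemma pre_map_measurable:
  assumes "t \<ge> 1"
  shows "(\<lambda>\<omega>. (history A R t \<omega>, A t \<omega>, \<lambda>(i, a)\<in>{1..t} \<times> {1, 2}. \<theta> i a \<omega>)) \<in> M \<rightarrow>\<^sub>M
     (count_space UNIV \<Otimes>\<^sub>M count_space UNIV \<Otimes>\<^sub>M (\<Pi>\<^sub>M ia\<in>{1..t} \<times> {1, 2}. borel))"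
proof -
  have "(\<lambda>\<omega>. \<lambda>(i, a)\<in>{1..t} \<times> {1, 2}. \<theta> i a \<omega>) \<in> M \<rightarrow>\<^sub>M (\<Pi>\<^sub>M ia\<in>{1..t} \<times> {1, 2}. borel)"
    by (rule measurable_restrict) (use sample_measurable in auto)
  then show ?thesis
    using history_measurable arm_measurable[OF assms] by (intro measurable_Pair) auto
qed

lemma finite_measure_subalgebra_pre:
  assumes "t \<ge> 1" shows "finite_measure_subalgebra M (pre t)"
proof
  show "subalgebra M (pre t)"
    unfolding subalgebra_def pre_reward_algebra_def
    using sets_image_in_sets[OF refl pre_map_measurable[OF assms]] by auto
qed

lemma history_measurable_pre: "history A R t \<in> pre t \<rightarrow>\<^sub>M count_space UNIV"
  and arm_measurable_pre: "A t \<in> pre t \<rightarrow>\<^sub>M count_space UNIV"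
proof -
  let ?f = "\<lambda>\<omega>. (history A R t \<omega>, A t \<omega>, \<lambda>(i, a)\<in>{1..t} \<times> {1, 2}. \<theta> i a \<omega>)"
  have *: "?f \<in> pre t \<rightarrow>\<^sub>M
      (count_space UNIV \<Otimes>\<^sub>M count_space UNIV \<Otimes>\<^sub>M (\<Pi>\<^sub>M ia\<in>{1..t} \<times> {1, 2}. borel))"
    unfolding pre_reward_algebra_def
    by (rule measurable_vimage_algebra1) (auto simp: space_pair_measure space_PiM)
  show "history A R t \<in> pre t \<rightarrow>\<^sub>M count_space UNIV" "A t \<in> pre t \<rightarrow>\<^sub>M count_space UNIV"
    using measurable_compose[OF * measurable_fst]
      measurable_compose[OF measurable_compose[OF * measurable_snd] measurable_fst] by simp_all
qed

text \<open>The history is a component of the map that generates the finer algebra. This makes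
  history-dependent weights admissible in \<open>integral_reward\<close>.\<close>

lemma measurable_hist_pre: "f \<in> hist t \<rightarrow>\<^sub>M N \<Longrightarrow> f \<in> pre t \<rightarrow>\<^sub>M N"
proof -
  have "sets (hist t) \<subseteq> sets (pre t)"
    unfolding history_algebra_def
    by (rule sets_image_in_sets[OF _ history_measurable_pre]) (simp add: pre_reward_algebra_def)
  then have "hist t \<rightarrow>\<^sub>M N \<subseteq> pre t \<rightarrow>\<^sub>M N"
    by (intro measurable_mono) (simp_all add: pre_reward_algebra_def)
  then show "f \<in> hist t \<rightarrow>\<^sub>M N \<Longrightarrow> f \<in> pre t \<rightarrow>\<^sub>M N"
    by (rule subsetD)
qed

section \<open>Posteriors, and the sampling and reward laws in integrated form\<close>

definition posterior :: "nat \<Rightarrow> nat \<Rightarrow> 'w \<Rightarrow> real measure" where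
  "posterior t a \<omega> = beta_distr (1 + real (successes A R a t \<omega>))
     (1 + real (pulls A a t \<omega>) - real (successes A R a t \<omega>))"

lemma prob_space_posterior: "\<omega> \<in> space M \<Longrightarrow> prob_space (posterior t a \<omega>)"
  unfolding posterior_def using successes_le_pulls[of \<omega> a t] by (intro prob_space_beta_distr) auto

lemma posterior_le_1: "\<omega> \<in> space M \<Longrightarrow> measure (posterior t a \<omega>) X \<le> 1"
  by (rule prob_space.prob_le_1[OF prob_space_posterior])

text \<open>The posterior factors through the pair of counts, which takes values in a countable
  discrete space, where every function is measurable.\<close>

lemma posterior_measurable: "(\<lambda>\<omega>. measure (posterior t a \<omega>) X) \<in> borel_measurable (hist t)"
proof -
  have "(\<lambda>\<omega>. (successes A R a t \<omega>, pulls A a t \<omega>)) \<in>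
      hist t \<rightarrow>\<^sub>M (count_space UNIV \<Otimes>\<^sub>M count_space UNIV)"
    by (intro measurable_Pair pulls_measurable_hist successes_measurable_hist) auto
  then have *: "(\<lambda>\<omega>. (successes A R a t \<omega>, pulls A a t \<omega>)) \<in> hist t \<rightarrow>\<^sub>M count_space UNIV"
    by (simp add: pair_measure_countable)
  have "(\<lambda>(s, n). measure (beta_distr (1 + real s) (1 + real n - real s)) X) \<in>
      count_space UNIV \<rightarrow>\<^sub>M borel"
    by simp
  from measurable_compose[OF * this] show ?thesis
    by (simp add: posterior_def)
qed

text \<open>The sampling law tested against bounded history-measurable weights. Later arguments use
  this form and never handle conditional expectations directly.\<close>

lemma integral_samples:
  fixes f :: "'w \<Rightarrow> real"
  assumes t: "t \<ge> 1" and f: "f \<in> borel_measurable (hist t)"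
    and bdd: "\<And>\<omega>. \<omega> \<in> space M \<Longrightarrow> \<bar>f \<omega>\<bar> \<le> C"
    and ab: "a \<in> {1, 2}" "b \<in> {1, 2}" "a \<noteq> b" and X: "X \<in> sets borel" and Y: "Y \<in> sets borel"
  shows "(\<integral>\<omega>. f \<omega> * indicator {\<omega> \<in> space M. \<theta> t a \<omega> \<in> X \<and> \<theta> t b \<omega> \<in> Y} \<omega> \<partial>M) =
    (\<integral>\<omega>. f \<omega> * (measure (posterior t a \<omega>) X * measure (posterior t b \<omega>) Y) \<partial>M)"
proof -
  interpret F: finite_measure_subalgebra M "hist t"
    by (rule finite_measure_subalgebra_hist)
  have *: "(\<integral>\<omega>. f \<omega> * indicator {\<omega> \<in> space M. \<theta> t 1 \<omega> \<in> X \<and> \<theta> t 2 \<omega> \<in> Y} \<omega> \<partial>M) =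
      (\<integral>\<omega>. f \<omega> * (measure (posterior t 1 \<omega>) X * measure (posterior t 2 \<omega>) Y) \<partial>M)"
    if X[measurable]: "X \<in> sets borel" and Y[measurable]: "Y \<in> sets borel" for X Y
  proof -
    have [measurable]: "\<theta> t 1 \<in> borel_measurable M" "\<theta> t 2 \<in> borel_measurable M"
      "f \<in> borel_measurable M" "\<And>a X. (\<lambda>\<omega>. measure (posterior t a \<omega>) X) \<in> borel_measurable M"
      using sample_measurable[OF t] by (auto intro: measurable_hist f posterior_measurable)
    have S [measurable]: "{\<omega> \<in> space M. \<theta> t 1 \<omega> \<in> X \<and> \<theta> t 2 \<omega> \<in> Y} \<in> sets M"
      by measurable
    have "(\<integral>\<omega>. f \<omega> * indicator {\<omega> \<in> space M. \<theta> t 1 \<omega> \<in> X \<and> \<theta> t 2 \<omega> \<in> Y} \<omega> \<partial>M) =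
      (\<integral>\<omega>. f \<omega> * real_cond_exp M (hist t)
        (indicator {\<omega> \<in> space M. \<theta> t 1 \<omega> \<in> X \<and> \<theta> t 2 \<omega> \<in> Y}) \<omega> \<partial>M)"
      by (intro F.real_cond_exp_intg(2)[symmetric] integrable_times_bounded[OF _ _ bdd] f borel_measurable_indicator S) auto
    also have "\<dots> = (\<integral>\<omega>. f \<omega> * (measure (posterior t 1 \<omega>) X * measure (posterior t 2 \<omega>) Y) \<partial>M)"
      by (rule integral_cong_AE)
        (use sample_law[OF t X Y] in \<open>auto simp: posterior_def[symmetric] borel_measurable_cond_exp2\<close>)
    finally show ?thesis .
  qed
  show ?thesis
  proof (cases "a = 1")
    case True
    then show ?thesis using * X Y ab by auto
  next
    case False
    then have "a = 2" "b = 1" using ab by auto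
    then show ?thesis using *[OF Y X] by (simp add: conj_commute mult.commute)
  qed
qed

lemma integral_sample:
  fixes f :: "'w \<Rightarrow> real"
  assumes "t \<ge> 1" "f \<in> borel_measurable (hist t)"
    "\<And>\<omega>. \<omega> \<in> space M \<Longrightarrow> \<bar>f \<omega>\<bar> \<le> C" "a \<in> {1, 2}" "X \<in> sets borel"
  shows "(\<integral>\<omega>. f \<omega> * indicator {\<omega> \<in> space M. \<theta> t a \<omega> \<in> X} \<omega> \<partial>M) =
    (\<integral>\<omega>. f \<omega> * measure (posterior t a \<omega>) X \<partial>M)"
proof -
  \<comment> \<open>\<open>3 - a\<close> is the other arm; leaving its sample unrestricted
    contributes the factor 1.\<close>
  have "measure (posterior t (3 - a) \<omega>) UNIV = 1" if "\<omega> \<in> space M" for \<omega>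
    using prob_space.prob_space[OF prob_space_posterior[OF that, of t "3 - a"]]
    by (simp add: posterior_def)
  then have "(\<integral>\<omega>. f \<omega> * (measure (posterior t a \<omega>) X * measure (posterior t (3 - a) \<omega>) UNIV) \<partial>M) =
      (\<integral>\<omega>. f \<omega> * measure (posterior t a \<omega>) X \<partial>M)"
    by (intro Bochner_Integration.integral_cong) auto
  then show ?thesis
    using integral_samples[OF assms(1-4), of "3 - a" X UNIV] assms(4,5) by fastforce
qed

text \<open>The reward law in the same form. Here the weight may also depend on the arm pulled in
  round \<open>t\<close>, so the indicator of a pull can be part of it.\<close>

lemma integral_reward:
  fixes f :: "'w \<Rightarrow> real"
  assumes t: "t \<ge> 1" and f: "f \<in> borel_measurable (pre t)"
    and bdd: "\<And>\<omega>. \<omega> \<in> space M \<Longrightarrow> \<bar>f \<omega>\<bar> \<le> C"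
  shows "(\<integral>\<omega>. f \<omega> * real (R t \<omega>) \<partial>M) = (\<integral>\<omega>. f \<omega> * \<mu> (A t \<omega>) \<partial>M)"
proof -
  interpret F: finite_measure_subalgebra M "pre t"
    by (rule finite_measure_subalgebra_pre[OF t])
  have [measurable]: "f \<in> borel_measurable M"
    by (rule measurable_from_subalg[OF F.subalg f])
  note [measurable] = reward_measurable[OF t] arm_measurable[OF t]
  have "(\<integral>\<omega>. f \<omega> * real (R t \<omega>) \<partial>M) = (\<integral>\<omega>. f \<omega> * indicator {\<omega> \<in> space M. R t \<omega> = 1} \<omega> \<partial>M)"
    by (intro Bochner_Integration.integral_cong) (use reward_binary[OF t] in \<open>force simp: indicator_def\<close>)+
  also have "\<dots> = (\<integral>\<omega>. f \<omega> * real_cond_exp M (pre t) (indicator {\<omega> \<in> space M. R t \<omega> = 1}) \<omega> \<partial>M)"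
    by (intro F.real_cond_exp_intg(2)[symmetric] integrable_times_bounded[OF _ _ bdd] f)
      (auto simp: indicator_def)
  also have "\<dots> = (\<integral>\<omega>. f \<omega> * \<mu> (A t \<omega>) \<partial>M)"
    by (rule integral_cong_AE)
      (use reward_law[OF t] in \<open>auto simp: borel_measurable_cond_exp2\<close>)
  finally show ?thesis .
qed

section \<open>Concentration of the empirical means\<close>

text \<open>
  The exponential of this process is a supermartingale that is frozen once arm \<open>a\<close> has been pulled
  \<open>n\<close> times, so a deviation at the \<open>n\<close>-th pull stays visible at every later deterministic time. This
  replaces optional stopping.
\<close>

definition frozen_exponent :: "real \<Rightarrow> nat \<Rightarrow> nat \<Rightarrow> nat \<Rightarrow> 'w \<Rightarrow> real" where
  "frozen_exponent l a n t \<omega> = (\<Sum>i = 1..<t. if A i \<omega> = a \<and> pulls A a i \<omega> < n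
     then l * (real (R i \<omega>) - \<mu> a) - l\<^sup>2 / 8 else 0)"

lemma frozen_exponent_1 [simp]: "frozen_exponent l a n (Suc 0) \<omega> = 0"
  by (simp add: frozen_exponent_def)

lemma frozen_exponent_Suc:
  "t \<ge> 1 \<Longrightarrow> frozen_exponent l a n (Suc t) \<omega> = frozen_exponent l a n t \<omega> +
     (if A t \<omega> = a \<and> pulls A a t \<omega> < n then l * (real (R t \<omega>) - \<mu> a) - l\<^sup>2 / 8 else 0)"
  by (simp add: frozen_exponent_def)

lemma frozen_exponent_measurable: "frozen_exponent l a n t \<in> borel_measurable (hist t)"
proof -
  have [measurable]: "A i \<in> hist t \<rightarrow>\<^sub>M count_space UNIV" "R i \<in> hist t \<rightarrow>\<^sub>M count_space UNIV"
      "pulls A a i \<in> hist t \<rightarrow>\<^sub>M count_space UNIV" if "i \<in> {1..<t}" for i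
    using arm_measurable_hist[of i t] reward_measurable_hist[of i t] pulls_measurable_hist[of i t] that
    by auto
  show ?thesis
    unfolding frozen_exponent_def by measurable
qed

lemma frozen_exponent_le:
  assumes "0 \<le> \<mu> a" "\<mu> a \<le> 1" "\<omega> \<in> space M"
  shows "frozen_exponent l a n t \<omega> \<le> real t * \<bar>l\<bar>"
proof -
  have "frozen_exponent l a n t \<omega> \<le> real (card {1..<t}) * \<bar>l\<bar>"
    unfolding frozen_exponent_def
  proof (rule sum_bounded_above)
    fix i assume "i \<in> {1..<t}"
    then have "\<bar>real (R i \<omega>) - \<mu> a\<bar> \<le> 1"
      using reward_binary[of i \<omega>] assms by auto
    then have "\<bar>l * (real (R i \<omega>) - \<mu> a)\<bar> \<le> \<bar>l\<bar>"
      by (simp add: abs_mult mult_left_le)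
    then have "l * (real (R i \<omega>) - \<mu> a) \<le> \<bar>l\<bar>" "0 \<le> l\<^sup>2 / 8"
      by auto
    then show "(if A i \<omega> = a \<and> pulls A a i \<omega> < n then l * (real (R i \<omega>) - \<mu> a) - l\<^sup>2 / 8 else 0) \<le> \<bar>l\<bar>"
      by (simp, linarith)
  qed
  also have "\<dots> \<le> real t * \<bar>l\<bar>"
    by (intro mult_right_mono) auto
  finally show ?thesis .
qed

lemma integrable_exp_frozen_exponent:
  assumes "0 \<le> \<mu> a" "\<mu> a \<le> 1"
  shows "integrable M (\<lambda>\<omega>. exp (frozen_exponent l a n t \<omega>))"
proof (rule integrable_const_bound)
  show "AE \<omega> in M. norm (exp (frozen_exponent l a n t \<omega>)) \<le> exp (real t * \<bar>l\<bar>)"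
    using frozen_exponent_le[OF assms] by (intro AE_I2) simp
  show "(\<lambda>\<omega>. exp (frozen_exponent l a n t \<omega>)) \<in> borel_measurable M"
    by (intro borel_measurable_exp[THEN measurable_compose_rev] measurable_hist[OF frozen_exponent_measurable])
qed

text \<open>The supermartingale property in integrated form. A round that counts multiplies the
  exponential by a factor whose conditional mean is at most 1 by Hoeffding's lemma, and every other
  round leaves it unchanged. Whether a round counts is known before its reward.\<close>

lemma expectation_exp_frozen_exponent:
  assumes "0 \<le> \<mu> a" "\<mu> a \<le> 1" "t \<ge> 1"
  shows "expectation (\<lambda>\<omega>. exp (frozen_exponent l a n t \<omega>)) \<le> 1"
  using \<open>t \<ge> 1\<close>
proof (induction t rule: nat_induct_at_least)
  case base
  show ?case by (simp add: prob_space)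
next
  case (Suc t)
  define V where "V = (\<lambda>\<omega>. exp (frozen_exponent l a n t \<omega>))"
  define D where "D = (\<lambda>\<omega>. if A t \<omega> = a \<and> pulls A a t \<omega> < n then 1 else 0 :: real)"
  \<comment> \<open>\<open>c0\<close> and \<open>c1\<close> are the factors for reward 0 and reward
    1; fact \<open>c\<close> bounds their mean under the reward law of arm \<open>a\<close>.\<close>
  define c0 where "c0 = exp (l * (0 - \<mu> a)) * exp (- l\<^sup>2 / 8)"
  define c1 where "c1 = exp (l * (1 - \<mu> a)) * exp (- l\<^sup>2 / 8)"
  have c: "c0 * (1 - \<mu> a) + c1 * \<mu> a \<le> 1"
  proof -
    have "c0 * (1 - \<mu> a) + c1 * \<mu> a =
        ((1 - \<mu> a) * exp (l * (0 - \<mu> a)) + \<mu> a * exp (l * (1 - \<mu> a))) * exp (- l\<^sup>2 / 8)"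
      by (simp add: c0_def c1_def algebra_simps)
    also have "\<dots> \<le> exp (l\<^sup>2 / 8) * exp (- l\<^sup>2 / 8)"
      by (intro mult_right_mono bernoulli_mgf_le assms) auto
    finally show ?thesis by (simp add: exp_add[symmetric])
  qed
  note [measurable] = pulls_measurable_hist[of t t a, THEN measurable_hist_pre, simplified]
    arm_measurable_pre[of t] frozen_exponent_measurable[of l a n t, THEN measurable_hist_pre]
  have V_pre [measurable]: "V \<in> borel_measurable (pre t)" and D_pre [measurable]: "D \<in> borel_measurable (pre t)"
    unfolding V_def D_def by measurable
  interpret P: finite_measure_subalgebra M "pre t"
    by (rule finite_measure_subalgebra_pre[OF Suc.hyps])
  note [measurable] = V_pre[THEN measurable_from_subalg[OF P.subalg]]
    D_pre[THEN measurable_from_subalg[OF P.subalg]] reward_measurable[OF Suc.hyps]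
  have V_bdd: "0 \<le> V \<omega>" "V \<omega> \<le> exp (real t * \<bar>l\<bar>)" if "\<omega> \<in> space M" for \<omega>
    using frozen_exponent_le[OF assms(1,2) that] by (auto simp: V_def)
  have VD_bdd: "\<bar>V \<omega> * D \<omega>\<bar> \<le> exp (real t * \<bar>l\<bar>)" if "\<omega> \<in> space M" for \<omega>
    using V_bdd[OF that] by (auto simp: D_def)
  have V_int: "integrable M V"
    unfolding V_def by (rule integrable_exp_frozen_exponent[OF assms(1,2)])
  have VD_int: "integrable M (\<lambda>\<omega>. V \<omega> * D \<omega>)"
  proof (rule integrable_times_bounded)
    show "\<bar>V \<omega>\<bar> \<le> exp (real t * \<bar>l\<bar>)" "\<bar>D \<omega>\<bar> \<le> 1" if "\<omega> \<in> space M" for \<omega>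
      using V_bdd[OF that] by (simp_all add: D_def)
  qed measurable
  have VDR_int: "integrable M (\<lambda>\<omega>. V \<omega> * D \<omega> * real (R t \<omega>))"
  proof (rule integrable_times_bounded[OF _ _ VD_bdd])
    show "\<bar>real (R t \<omega>)\<bar> \<le> 1" if "\<omega> \<in> space M" for \<omega>
      using reward_le_1[OF Suc.hyps that] by simp
  qed measurable
  note int = V_int VD_int VDR_int
  \<comment> \<open>Because the reward is binary, the new exponential is affine in
    \<open>R t\<close>, which is the form that \<open>integral_reward\<close> can evaluate.\<close>
  have step: "exp (frozen_exponent l a n (Suc t) \<omega>) =
      V \<omega> + (c0 - 1) * (V \<omega> * D \<omega>) + (c1 - c0) * (V \<omega> * D \<omega> * real (R t \<omega>))" if \<omega>: "\<omega> \<in> space M" for \<omega>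
  proof -
    have c01: "c0 = exp (l * (0 - \<mu> a) - l\<^sup>2 / 8)" "c1 = exp (l * (1 - \<mu> a) - l\<^sup>2 / 8)"
      unfolding c0_def c1_def exp_add[symmetric] by simp_all
    consider "D \<omega> = 0" "\<not> (A t \<omega> = a \<and> pulls A a t \<omega> < n)"
      | "D \<omega> = 1" "A t \<omega> = a \<and> pulls A a t \<omega> < n" "R t \<omega> = 0"
      | "D \<omega> = 1" "A t \<omega> = a \<and> pulls A a t \<omega> < n" "R t \<omega> = 1"
      using reward_binary[OF Suc.hyps \<omega>] unfolding D_def
      by (cases "A t \<omega> = a \<and> pulls A a t \<omega> < n") auto
    then have "exp (frozen_exponent l a n (Suc t) \<omega>) =
        V \<omega> * (1 + D \<omega> * (c0 - 1 + (c1 - c0) * real (R t \<omega>)))"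
    proof cases
      case 1
      then show ?thesis
        unfolding frozen_exponent_Suc[OF Suc.hyps] V_def by auto
    next
      case 2
      then have "exp (frozen_exponent l a n (Suc t) \<omega>) = V \<omega> * c0"
        unfolding frozen_exponent_Suc[OF Suc.hyps] V_def c01 exp_add[symmetric] by simp
      then show ?thesis using 2 by simp
    next
      case 3
      then have "exp (frozen_exponent l a n (Suc t) \<omega>) = V \<omega> * c1"
        unfolding frozen_exponent_Suc[OF Suc.hyps] V_def c01 exp_add[symmetric] by simp
      then show ?thesis using 3 by simp
    qed
    also have "\<dots> = V \<omega> + (c0 - 1) * (V \<omega> * D \<omega>) + (c1 - c0) * (V \<omega> * D \<omega> * real (R t \<omega>))"
      by algebra
    finally show ?thesis .
  qed
  have "expectation (\<lambda>\<omega>. exp (frozen_exponent l a n (Suc t) \<omega>)) =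
      expectation (\<lambda>\<omega>. V \<omega> + (c0 - 1) * (V \<omega> * D \<omega>) + (c1 - c0) * (V \<omega> * D \<omega> * real (R t \<omega>)))"
    using step by (intro Bochner_Integration.integral_cong) auto
  also have "\<dots> = expectation V + (c0 - 1) * expectation (\<lambda>\<omega>. V \<omega> * D \<omega>) +
      (c1 - c0) * expectation (\<lambda>\<omega>. V \<omega> * D \<omega> * real (R t \<omega>))"
    using int by simp
  also have "expectation (\<lambda>\<omega>. V \<omega> * D \<omega> * real (R t \<omega>)) = expectation (\<lambda>\<omega>. V \<omega> * D \<omega> * \<mu> (A t \<omega>))"
    by (rule integral_reward[OF Suc.hyps _ VD_bdd]) (auto simp: D_def)
  \<comment> \<open>Where \<open>D\<close> does not vanish the pulled arm is \<open>a\<close>, so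
    the mean becomes a constant.\<close>
  also have "\<dots> = expectation (\<lambda>\<omega>. \<mu> a * (V \<omega> * D \<omega>))"
    by (intro Bochner_Integration.integral_cong) (auto simp: D_def)
  also have "\<dots> = \<mu> a * expectation (\<lambda>\<omega>. V \<omega> * D \<omega>)"
    by simp
  also have "expectation V + (c0 - 1) * expectation (\<lambda>\<omega>. V \<omega> * D \<omega>) +
      (c1 - c0) * (\<mu> a * expectation (\<lambda>\<omega>. V \<omega> * D \<omega>)) =
      expectation V + (c0 * (1 - \<mu> a) + c1 * \<mu> a - 1) * expectation (\<lambda>\<omega>. V \<omega> * D \<omega>)"
    by (simp add: algebra_simps)
  also have "\<dots> \<le> expectation V + 0"
  proof (intro add_left_mono mult_nonpos_nonneg)
    show "0 \<le> expectation (\<lambda>\<omega>. V \<omega> * D \<omega>)"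
      using V_bdd by (intro integral_nonneg_AE AE_I2) (auto simp: D_def)
  qed (use c in auto)
  finally show ?case
    using Suc.IH by (simp add: V_def)
qed

text \<open>As long as the counter does not exceed \<open>n\<close>, every earlier pull of the arm,
  the \<open>n\<close>-th included, took place at a counter value below \<open>n\<close> and so
  contributes to the sum.\<close>

lemma frozen_exponent_before:
  assumes "t \<ge> 1" "pulls A a t \<omega> \<le> n"
  shows "frozen_exponent l a n t \<omega> =
    l * (real (successes A R a t \<omega>) - \<mu> a * real (pulls A a t \<omega>)) - l\<^sup>2 / 8 * real (pulls A a t \<omega>)"
  using assms
proof (induction t rule: nat_induct_at_least)
  case (Suc t)
  then show ?case
    by (auto simp: frozen_exponent_Suc pulls_Suc successes_Suc algebra_simps split: if_splits)
qed simp

lemma frozen_exponent_after: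
  assumes "1 \<le> t" "t \<le> K" "n \<le> pulls A a t \<omega>"
  shows "frozen_exponent l a n K \<omega> = frozen_exponent l a n t \<omega>"
  using assms(2)
proof (induction K rule: dec_induct)
  case (step K)
  have "n \<le> pulls A a K \<omega>"
    using pulls_mono[OF step.hyps(1), of A a \<omega>] assms by simp
  then show ?case
    using step assms by (simp add: frozen_exponent_Suc)
qed simp

lemma prob_deviation:
  fixes n :: nat and c \<epsilon> :: real
  assumes a: "0 \<le> \<mu> a" "\<mu> a \<le> 1" and c: "c = 1 \<or> c = -1" and \<epsilon>: "\<epsilon> > 0"
  defines "E \<equiv> \<lambda>t \<omega>. pulls A a t \<omega> = n \<and> c * (real (successes A R a t \<omega>) - \<mu> a * real n) \<ge> \<epsilon> * real n"
  shows "{\<omega> \<in> space M. \<exists>t\<ge>1. E t \<omega>} \<in> events"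
    and "prob {\<omega> \<in> space M. \<exists>t\<ge>1. E t \<omega>} \<le> exp (- 2 * \<epsilon>\<^sup>2) ^ n"
proof -
  let ?B = "\<lambda>K. {\<omega> \<in> space M. \<exists>t\<in>{1..K}. E t \<omega>}"
  note [measurable] = pulls_measurable_hist[OF order_refl, THEN measurable_hist]
    successes_measurable_hist[OF order_refl, THEN measurable_hist]
    frozen_exponent_measurable[THEN measurable_hist]
  have B [measurable]: "?B K \<in> events" for K
    unfolding E_def by measurable
  show "{\<omega> \<in> space M. \<exists>t\<ge>1. E t \<omega>} \<in> events"
    unfolding E_def by measurable
  \<comment> \<open>Up to the sign, this \<open>l\<close> maximises
    \<open>l * \<epsilon> - l\<^sup>2 / 8\<close>; the maximum is
    \<open>2 * \<epsilon>\<^sup>2\<close>.\<close>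
  define l where "l = 4 * \<epsilon> * c"
  have l2: "l\<^sup>2 / 8 = 2 * \<epsilon>\<^sup>2"
    using c by (auto simp: l_def power2_eq_square)
  have bound: "prob (?B K) \<le> exp (- 2 * \<epsilon>\<^sup>2) ^ n" for K
  proof (cases "K \<ge> 1")
    case True
    let ?V = "\<lambda>\<omega>. exp (frozen_exponent l a n K \<omega>)"
    have "prob (?B K) \<le> prob {\<omega> \<in> space M. ?V \<omega> \<ge> exp (2 * \<epsilon>\<^sup>2 * real n)}"
    proof (intro finite_measure_mono subsetI)
      fix \<omega> assume "\<omega> \<in> ?B K"
      then obtain t where t: "\<omega> \<in> space M" "1 \<le> t" "t \<le> K" "pulls A a t \<omega> = n"
        and dev: "\<epsilon> * real n \<le> c * (real (successes A R a t \<omega>) - \<mu> a * real n)"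
        by (auto simp: E_def)
      have "frozen_exponent l a n K \<omega> = l * (real (successes A R a t \<omega>) - \<mu> a * real n) - l\<^sup>2 / 8 * real n"
        using t by (subst frozen_exponent_after[of t]) (auto simp: frozen_exponent_before)
      also have "\<dots> = 4 * \<epsilon> * (c * (real (successes A R a t \<omega>) - \<mu> a * real n)) - 2 * \<epsilon>\<^sup>2 * real n"
        unfolding l2 by (simp add: l_def)
      also have "\<dots> \<ge> 4 * \<epsilon> * (\<epsilon> * real n) - 2 * \<epsilon>\<^sup>2 * real n"
        using dev \<epsilon> by simp
      also have "4 * \<epsilon> * (\<epsilon> * real n) - 2 * \<epsilon>\<^sup>2 * real n = 2 * \<epsilon>\<^sup>2 * real n"
        by (simp add: power2_eq_square)
      finally show "\<omega> \<in> {\<omega> \<in> space M. ?V \<omega> \<ge> exp (2 * \<epsilon>\<^sup>2 * real n)}"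
        using t by simp
    qed measurable
    also have "\<dots> \<le> expectation ?V / exp (2 * \<epsilon>\<^sup>2 * real n)"
      by (rule integral_Markov_inequality_measure[where A = "{}"])
        (use integrable_exp_frozen_exponent[OF a] in auto)
    also have "\<dots> \<le> 1 / exp (2 * \<epsilon>\<^sup>2 * real n)"
      by (intro divide_right_mono expectation_exp_frozen_exponent a True) auto
    also have "\<dots> = exp (- 2 * \<epsilon>\<^sup>2) ^ n"
      by (simp add: exp_of_nat_mult[symmetric] exp_minus field_simps)
    finally show ?thesis .
  qed auto
  \<comment> \<open>The events increase with the horizon and the bound does not depend on it, so it
    survives the limit.\<close>
  have "(\<lambda>K. prob (?B K)) \<longlonglongrightarrow> prob (\<Union>K. ?B K)"
  proof (rule finite_Lim_measure_incseq)
    show "range ?B \<subseteq> events"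
      using B by blast
  qed (auto simp: incseq_def intro: order_trans)
  moreover have "(\<Union>K. ?B K) = {\<omega> \<in> space M. \<exists>t\<ge>1. E t \<omega>}"
    by (force intro: order_refl)
  ultimately have "(\<lambda>K. prob (?B K)) \<longlonglongrightarrow> prob {\<omega> \<in> space M. \<exists>t\<ge>1. E t \<omega>}"
    by simp
  then show "prob {\<omega> \<in> space M. \<exists>t\<ge>1. E t \<omega>} \<le> exp (- 2 * \<epsilon>\<^sup>2) ^ n"
    by (rule LIMSEQ_le_const2) (use bound in auto)
qed

text \<open>Borel-Cantelli along the counter values instead of along time, so the speed at which the
  arm is pulled does not enter. On paths where the arm is pulled only finitely often the conclusion
  carries no information, since \<open>n0\<close> may depend on the path.\<close>

lemma AE_empirical_mean:
  assumes a: "0 \<le> \<mu> a" "\<mu> a \<le> 1" and \<epsilon>: "\<epsilon> > 0"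
  shows "AE \<omega> in M. \<exists>n0. \<forall>t\<ge>1. n0 \<le> pulls A a t \<omega> \<longrightarrow>
    \<bar>real (successes A R a t \<omega>) - \<mu> a * real (pulls A a t \<omega>)\<bar> < \<epsilon> * real (pulls A a t \<omega>)"
proof -
  define E where "E c n = {\<omega> \<in> space M. \<exists>t\<ge>1. pulls A a t \<omega> = n \<and>
    c * (real (successes A R a t \<omega>) - \<mu> a * real n) \<ge> \<epsilon> * real n}" for c :: real and n
  have ev: "AE \<omega> in M. eventually (\<lambda>n. \<omega> \<in> space M - E c n) sequentially" if "c = 1 \<or> c = -1" for c
  proof (rule borel_cantelli_AE1)
    show "summable (\<lambda>n. prob (E c n))"
    proof (rule summable_comparison_test')
      show "summable (\<lambda>n. exp (- 2 * \<epsilon>\<^sup>2) ^ n)"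
        using \<epsilon> by (intro summable_geometric) auto
      show "norm (prob (E c n)) \<le> exp (- 2 * \<epsilon>\<^sup>2) ^ n" for n
        unfolding E_def using prob_deviation(2)[OF a that \<epsilon>, of n] by (simp only: real_norm_def abs_of_nonneg measure_nonneg)
    qed
    show "E c n \<in> events" for n
      unfolding E_def by (rule prob_deviation(1)[OF a that \<epsilon>])
  qed (simp add: less_top[symmetric])
  have "AE \<omega> in M. eventually (\<lambda>n. \<omega> \<in> space M - E 1 n) sequentially"
    "AE \<omega> in M. eventually (\<lambda>n. \<omega> \<in> space M - E (- 1) n) sequentially"
    by (rule ev, simp)+
  then show ?thesis
  proof eventually_elim
    case (elim \<omega>)
    then have "eventually (\<lambda>n. \<omega> \<in> space M - E 1 n \<and> \<omega> \<in> space M - E (- 1) n) sequentially"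
      by (rule eventually_conj)
    then obtain n0 where n0: "\<And>n. n \<ge> n0 \<Longrightarrow> \<omega> \<in> space M - E 1 n \<and> \<omega> \<in> space M - E (- 1) n"
      by (auto simp: eventually_sequentially)
    show ?case
    proof (intro exI allI impI)
      fix t :: nat assume "t \<ge> 1" "n0 \<le> pulls A a t \<omega>"
      then show "\<bar>real (successes A R a t \<omega>) - \<mu> a * real (pulls A a t \<omega>)\<bar> < \<epsilon> * real (pulls A a t \<omega>)"
        using n0[of "pulls A a t \<omega>"] unfolding E_def by (auto simp: not_le abs_less_iff)
    qed
  qed
qed

end

section \<open>Both arms are pulled infinitely often\<close>

lemma sum_over_pulls:
  fixes v :: "nat \<Rightarrow> real"
  assumes "t \<ge> 1"
  shows "(\<Sum>i = 1..<t. if A i \<omega> = a then v (pulls A a i \<omega>) else 0) = (\<Sum>n<pulls A a t \<omega>. v n)"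
  using assms by (induction t rule: nat_induct_at_least) (auto simp: pulls_Suc)

text \<open>The first Borel-Cantelli lemma for events indexed by rounds. The shift to
  \<open>Suc t\<close> skips index 0, which is not a round.\<close>

lemma (in prob_space) AE_eventually_not:
  assumes meas: "\<And>t. t \<ge> 1 \<Longrightarrow> {\<omega> \<in> space M. P t \<omega>} \<in> events"
    and bdd: "\<And>K. (\<Sum>t = 1..<K. prob {\<omega> \<in> space M. P t \<omega>}) \<le> C"
  shows "AE \<omega> in M. eventually (\<lambda>t. \<not> P t \<omega>) sequentially"
proof -
  have "summable (\<lambda>t. prob {\<omega> \<in> space M. P (Suc t) \<omega>})"
  proof (rule summableI_nonneg_bounded)
    show "(\<Sum>t<K. prob {\<omega> \<in> space M. P (Suc t) \<omega>}) \<le> C" for K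
      using bdd[of "Suc K"] by (simp add: sum.atLeast_Suc_lessThan_Suc_shift lessThan_atLeast0 del: sum.op_ivl_Suc)
  qed simp
  then have "AE \<omega> in M. eventually (\<lambda>t. \<omega> \<in> space M - {\<omega> \<in> space M. P (Suc t) \<omega>}) sequentially"
    using meas by (intro borel_cantelli_AE1) (auto simp: less_top[symmetric])
  then show ?thesis
  proof eventually_elim
    case (elim \<omega>)
    then have "eventually (\<lambda>t. \<not> P (Suc t) \<omega>) sequentially"
      by (rule eventually_mono) auto
    then show ?case
      by (rule eventually_sequentially_Suc[THEN iffD1])
  qed
qed

lemma ex_beta_tail_le:
  assumes "\<epsilon> \<noteq> 0" "\<eta> > 0"
  obtains n0 where "\<And>n. n \<ge> n0 \<Longrightarrow> beta_tail \<epsilon> n \<le> \<eta>"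
proof -
  have "eventually (\<lambda>n. beta_tail \<epsilon> n < \<eta>) sequentially"
    using summable_LIMSEQ_zero[OF summable_beta_tail[OF assms(1)]] assms(2) by (rule order_tendstoD)
  then show ?thesis
    using that by (auto simp: eventually_sequentially intro: less_imp_le)
qed

context thompson_sampling
begin

text \<open>Written without division; the strict inequality already forces at least one pull. The
  threshold \<open>n0\<close> will make the posterior tail smaller than a fixed constant.\<close>

definition good :: "real \<Rightarrow> nat \<Rightarrow> nat \<Rightarrow> nat \<Rightarrow> 'w \<Rightarrow> bool" where
  "good \<epsilon> n0 a t \<omega> \<longleftrightarrow> n0 \<le> pulls A a t \<omega> \<and>
     \<bar>real (successes A R a t \<omega>) - \<mu> a * real (pulls A a t \<omega>)\<bar> < \<epsilon> * real (pulls A a t \<omega>)"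

lemma good_measurable: "s \<le> t \<Longrightarrow> Measurable.pred (hist t) (good \<epsilon> n0 a s)"
proof -
  assume "s \<le> t"
  note [measurable] = pulls_measurable_hist[OF this] successes_measurable_hist[OF this]
  show ?thesis
    unfolding good_def by measurable
qed

text \<open>Triangle inequality: the empirical mean is within \<epsilon> of the true mean, so a
  point \<open>2 * \<epsilon>\<close> away from the latter is at least \<epsilon> away from the
  former.\<close>

lemma posterior_tail:
  assumes "good \<epsilon> n0 a t \<omega>" "\<omega> \<in> space M" "0 < \<epsilon>" "\<epsilon> \<le> 1" "X \<in> sets borel"
    and X: "\<And>x. x \<in> X \<Longrightarrow> 2 * \<epsilon> \<le> \<bar>x - \<mu> a\<bar>"
  shows "measure (posterior t a \<omega>) X \<le> beta_tail \<epsilon> (pulls A a t \<omega>)"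
  unfolding posterior_def
proof (rule measure_beta_distr_tail)
  let ?s = "real (successes A R a t \<omega>)" and ?n = "real (pulls A a t \<omega>)"
  have dev: "\<bar>?s - \<mu> a * ?n\<bar> < \<epsilon> * ?n"
    using assms(1) by (simp add: good_def)
  then show n: "0 < pulls A a t \<omega>"
    by (cases "pulls A a t \<omega>") auto
  have "\<bar>?s / ?n - \<mu> a\<bar> = \<bar>?s - \<mu> a * ?n\<bar> / ?n"
  proof -
    have "?s / ?n - \<mu> a = (?s - \<mu> a * ?n) / ?n"
      using n by (simp add: field_simps)
    then show ?thesis by (simp add: abs_divide)
  qed
  also have "\<dots> < \<epsilon>"
    using dev n by (simp add: pos_divide_less_eq)
  finally show "\<epsilon> \<le> \<bar>x - ?s / ?n\<bar>" if "x \<in> X" for x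
    using X[OF that] by linarith
qed (use assms successes_le_pulls in auto)

text \<open>
  Each value of the pull counter is used by at most one pull, so sums over time along the pulls
  of an arm are sums over its pull counter.
\<close>

lemma pulls_expectation_sum_le:
  fixes v :: "nat \<Rightarrow> real"
  assumes v: "\<And>n. v n \<ge> 0" "summable v"
  shows "(\<Sum>t = 1..<K. expectation (\<lambda>\<omega>. v (pulls A a t \<omega>) * indicator {\<omega> \<in> space M. A t \<omega> = a} \<omega>)) \<le> suminf v"
proof (cases "K \<ge> 1")
  case True
  note [measurable] = pulls_measurable_hist[OF order_refl, THEN measurable_hist] arm_measurable
  have v_le: "v n \<le> suminf v" for n
    using sum_le_suminf[OF v(2), of "{n}"] v(1) by simp
  have int: "integrable M (\<lambda>\<omega>. v (pulls A a t \<omega>) * indicator {\<omega> \<in> space M. A t \<omega> = a} \<omega>)"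
    if "t \<ge> 1" for t
  proof (rule integrable_times_bounded)
    show "indicator {\<omega> \<in> space M. A t \<omega> = a} \<in> borel_measurable M"
      using that by measurable
    show "\<bar>v (pulls A a t \<omega>)\<bar> \<le> suminf v" for \<omega>
      using v v_le by simp
  qed (auto simp: indicator_def)
  have "(\<Sum>t = 1..<K. expectation (\<lambda>\<omega>. v (pulls A a t \<omega>) * indicator {\<omega> \<in> space M. A t \<omega> = a} \<omega>)) =
      expectation (\<lambda>\<omega>. \<Sum>t = 1..<K. v (pulls A a t \<omega>) * indicator {\<omega> \<in> space M. A t \<omega> = a} \<omega>)"
    using int by (intro Bochner_Integration.integral_sum[symmetric]) auto
  also have "\<dots> \<le> expectation (\<lambda>\<omega>. suminf v)"
  proof (intro integral_mono Bochner_Integration.integrable_sum int)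
    fix \<omega> assume \<omega>: "\<omega> \<in> space M"
    have "(\<Sum>t = 1..<K. v (pulls A a t \<omega>) * indicator {\<omega> \<in> space M. A t \<omega> = a} \<omega>) =
        (\<Sum>t = 1..<K. if A t \<omega> = a then v (pulls A a t \<omega>) else 0)"
      using \<omega> by (intro sum.cong) auto
    also have "\<dots> = (\<Sum>n<pulls A a K \<omega>. v n)"
      by (rule sum_over_pulls[OF True])
    also have "\<dots> \<le> suminf v"
      using v by (intro sum_le_suminf) auto
    finally show "(\<Sum>t = 1..<K. v (pulls A a t \<omega>) * indicator {\<omega> \<in> space M. A t \<omega> = a} \<omega>) \<le> suminf v" .
  qed auto
  finally show ?thesis by (simp add: prob_space)
qed (use v in \<open>auto intro: suminf_nonneg\<close>)

text \<open>
  On the event below arm \<open>a\<close> is pulled with conditional probability at least a constant depending on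
  \<open>n\<close> only, but at most one pull of arm \<open>a\<close> takes place at counter value \<open>n\<close>.
\<close>

lemma AE_not_stuck:
  assumes ab: "a \<in> {1, 2}" "b \<in> {1, 2}" "a \<noteq> b"
    and \<epsilon>: "0 < \<epsilon>" "\<epsilon> \<le> 1" and c: "0 \<le> \<mu> b" "\<mu> b + 2 * \<epsilon> < 1"
    and n0: "\<And>n. n \<ge> n0 \<Longrightarrow> beta_tail \<epsilon> n \<le> 1 / 2"
  shows "AE \<omega> in M. eventually (\<lambda>t. \<not> (pulls A a t \<omega> = n \<and> good \<epsilon> n0 b t \<omega>)) sequentially"
proof -
  \<comment> \<open>The level that separates the samples: arm \<open>b\<close> stays below it with
    probability at least 1/2, and since it is below 1, arm \<open>a\<close> can exceed it.\<close>
  define c where "c = \<mu> b + 2 * \<epsilon>"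
  \<comment> \<open>After \<open>n\<close> pulls only the success counts up to \<open>n\<close> are
    possible, so the chance of arm \<open>a\<close> is a minimum of finitely many positive
    numbers.\<close>
  define \<delta> where "\<delta> = Min ((\<lambda>s. measure (beta_distr (1 + real s) (1 + real n - real s)) {c<..}) ` {..n})"
  have \<delta>_pos: "\<delta> > 0"
    unfolding \<delta>_def using assms by (subst Min_gr_iff) (auto simp: c_def intro!: measure_beta_distr_pos)
  have \<delta>_le: "\<delta> \<le> measure (posterior t a \<omega>) {c<..}" if "pulls A a t \<omega> = n" "\<omega> \<in> space M" for t \<omega>
    unfolding \<delta>_def posterior_def using that successes_le_pulls[of \<omega> a t] by (intro Min_le) auto
  have half: "1 / 2 \<le> measure (posterior t b \<omega>) {..<c}" if "good \<epsilon> n0 b t \<omega>" "\<omega> \<in> space M" for t \<omega>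
  proof -
    interpret P: prob_space "posterior t b \<omega>"
      by (rule prob_space_posterior[OF that(2)])
    have "measure (posterior t b \<omega>) {c..} \<le> beta_tail \<epsilon> (pulls A b t \<omega>)"
      by (rule posterior_tail) (use that \<epsilon> in \<open>auto simp: c_def\<close>)
    also have "\<dots> \<le> 1 / 2"
      using that by (intro n0) (simp add: good_def)
    finally have "measure (posterior t b \<omega>) (space (posterior t b \<omega>) - {c..}) \<ge> 1 / 2"
      by (subst P.prob_compl) (auto simp: posterior_def)
    also have "space (posterior t b \<omega>) - {c..} = {..<c}"
      by (auto simp: posterior_def)
    finally show ?thesis .
  qed
  \<comment> \<open>With the indicator of the single counter value \<open>n\<close>, the sum along
    the pulls of \<open>a\<close> is at most 1.\<close>
  define v :: "nat \<Rightarrow> real" where "v m = (if m = n then 1 else 0)" for m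
  have v: "v sums 1"
    unfolding v_def using sums_single[of n "\<lambda>_. 1"] by simp
  let ?P = "\<lambda>t \<omega>. pulls A a t \<omega> = n \<and> good \<epsilon> n0 b t \<omega>"
  have P_meas: "{\<omega> \<in> space M. ?P t \<omega>} \<in> sets (hist t)" for t
  proof -
    note [measurable] = pulls_measurable_hist[OF order_refl] good_measurable[OF order_refl]
    have "{\<omega> \<in> space (hist t). ?P t \<omega>} \<in> sets (hist t)"
      by measurable
    then show ?thesis by simp
  qed
  \<comment> \<open>Given the history the samples are independent, which multiplies the chance
    \<delta> of arm \<open>a\<close> being above the level by the chance 1/2 of arm \<open>b\<close>
    being below it.\<close>
  have bound: "\<delta> / 2 * prob {\<omega> \<in> space M. ?P t \<omega>} \<le>
      expectation (\<lambda>\<omega>. v (pulls A a t \<omega>) * indicator {\<omega> \<in> space M. A t \<omega> = a} \<omega>)" if t: "t \<ge> 1" for t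
  proof -
    let ?f = "indicator {\<omega> \<in> space M. ?P t \<omega>} :: 'w \<Rightarrow> real"
    have f: "?f \<in> borel_measurable (hist t)"
      using P_meas by measurable
    note [measurable] = measurable_hist[OF f] sets_hist[OF P_meas] measurable_hist[OF posterior_measurable]
      pulls_measurable_hist[OF order_refl, THEN measurable_hist] arm_measurable[OF t]
    have "\<theta> t a \<in> borel_measurable M" "\<theta> t b \<in> borel_measurable M"
      using sample_measurable[OF t] ab by auto
    note [measurable] = this
    have "\<delta> / 2 * prob {\<omega> \<in> space M. ?P t \<omega>} = expectation (\<lambda>\<omega>. ?f \<omega> * (\<delta> / 2))"
      by (simp add: sets_hist[OF P_meas])
    also have "\<dots> \<le> expectation (\<lambda>\<omega>. ?f \<omega> * (measure (posterior t a \<omega>) {c<..} * measure (posterior t b \<omega>) {..<c}))"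
    proof (rule integral_mono)
      show "integrable M (\<lambda>\<omega>. ?f \<omega> * (\<delta> / 2))"
        by (simp add: sets_hist[OF P_meas] less_top[symmetric])
      show "integrable M (\<lambda>\<omega>. ?f \<omega> * (measure (posterior t a \<omega>) {c<..} * measure (posterior t b \<omega>) {..<c}))"
      proof (rule integrable_times_bounded)
        show "\<bar>?f \<omega>\<bar> \<le> 1" for \<omega> by (simp add: indicator_def)
        show "\<bar>measure (posterior t a \<omega>) {c<..} * measure (posterior t b \<omega>) {..<c}\<bar> \<le> 1" if "\<omega> \<in> space M" for \<omega>
          using posterior_le_1[OF that] by (auto intro!: mult_le_one)
      qed measurable
      fix \<omega> assume \<omega>: "\<omega> \<in> space M"
      show "?f \<omega> * (\<delta> / 2) \<le> ?f \<omega> * (measure (posterior t a \<omega>) {c<..} * measure (posterior t b \<omega>) {..<c})"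
      proof (cases "?P t \<omega>")
        case True
        then have "\<delta> * (1 / 2) \<le> measure (posterior t a \<omega>) {c<..} * measure (posterior t b \<omega>) {..<c}"
          using \<delta>_le half \<omega> \<delta>_pos by (intro mult_mono) auto
        then show ?thesis using True \<omega> by simp
      qed simp
    qed
    also have "\<dots> = expectation (\<lambda>\<omega>. ?f \<omega> * indicator {\<omega> \<in> space M. \<theta> t a \<omega> \<in> {c<..} \<and> \<theta> t b \<omega> \<in> {..<c}} \<omega>)"
      by (rule integral_samples[OF t f _ ab, of 1, symmetric]) (auto simp: indicator_def)
    also have "\<dots> \<le> expectation (\<lambda>\<omega>. v (pulls A a t \<omega>) * indicator {\<omega> \<in> space M. A t \<omega> = a} \<omega>)"
    proof (rule integral_mono)
      show "integrable M (\<lambda>\<omega>. ?f \<omega> * indicator {\<omega> \<in> space M. \<theta> t a \<omega> \<in> {c<..} \<and> \<theta> t b \<omega> \<in> {..<c}} \<omega>)"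
      proof (rule integrable_times_bounded)
        show "\<bar>?f \<omega>\<bar> \<le> 1"
          "\<bar>indicator {\<omega> \<in> space M. \<theta> t a \<omega> \<in> {c<..} \<and> \<theta> t b \<omega> \<in> {..<c}} \<omega> :: real\<bar> \<le> 1" for \<omega>
          by (simp_all add: indicator_def)
      qed measurable
      show "integrable M (\<lambda>\<omega>. v (pulls A a t \<omega>) * indicator {\<omega> \<in> space M. A t \<omega> = a} \<omega>)"
      proof (rule integrable_times_bounded)
        show "\<bar>v (pulls A a t \<omega>)\<bar> \<le> 1" "\<bar>indicator {\<omega> \<in> space M. A t \<omega> = a} \<omega> :: real\<bar> \<le> 1" for \<omega>
          by (simp_all add: v_def indicator_def)
      qed measurable
      fix \<omega> assume \<omega>: "\<omega> \<in> space M"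
      have "A t \<omega> = a" if "c < \<theta> t a \<omega>" "\<theta> t b \<omega> < c"
        using arm_choice[OF t \<omega>] that ab by (auto simp: is_arg_max_def)
      then show "?f \<omega> * indicator {\<omega> \<in> space M. \<theta> t a \<omega> \<in> {c<..} \<and> \<theta> t b \<omega> \<in> {..<c}} \<omega> \<le>
          v (pulls A a t \<omega>) * indicator {\<omega> \<in> space M. A t \<omega> = a} \<omega>"
        by (auto simp: indicator_def v_def)
    qed
    finally show ?thesis .
  qed
  show ?thesis
  proof (rule AE_eventually_not)
    fix K
    have "\<delta> / 2 * (\<Sum>t = 1..<K. prob {\<omega> \<in> space M. ?P t \<omega>}) \<le>
        (\<Sum>t = 1..<K. expectation (\<lambda>\<omega>. v (pulls A a t \<omega>) * indicator {\<omega> \<in> space M. A t \<omega> = a} \<omega>))"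
      unfolding sum_distrib_left by (intro sum_mono bound) auto
    also have "\<dots> \<le> suminf v"
      using v by (intro pulls_expectation_sum_le) (auto simp: v_def sums_iff)
    also have "\<dots> = 1"
      using v by (simp add: sums_iff)
    finally show "(\<Sum>t = 1..<K. prob {\<omega> \<in> space M. ?P t \<omega>}) \<le> 2 / \<delta>"
      using \<delta>_pos by (simp add: field_simps)
  qed (use sets_hist[OF P_meas] in simp)
qed

text \<open>A bounded counter of arm \<open>a\<close> is eventually constant. Since the two counters
  add up to \<open>t - 1\<close>, arm \<open>b\<close> then takes all remaining rounds and becomes
  good, which is the situation excluded by \<open>AE_not_stuck\<close>.\<close>

lemma AE_pulls_unbounded:
  assumes ab: "a \<in> {1, 2}" "b \<in> {1, 2}" "a \<noteq> b" and b: "0 \<le> \<mu> b" "\<mu> b < 1"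
  shows "AE \<omega> in M. \<forall>n. \<exists>t\<ge>1. n < pulls A a t \<omega>"
proof -
  define \<epsilon> where "\<epsilon> = (1 - \<mu> b) / 3"
  have \<epsilon>: "0 < \<epsilon>" "\<epsilon> \<le> 1" "\<mu> b + 2 * \<epsilon> < 1"
    using b by (auto simp: \<epsilon>_def field_simps)
  obtain n0 where n0: "\<And>n. n \<ge> n0 \<Longrightarrow> beta_tail \<epsilon> n \<le> 1 / 2"
    using ex_beta_tail_le[of \<epsilon> "1 / 2"] \<epsilon> by auto
  have "AE \<omega> in M. \<forall>n. eventually (\<lambda>t. \<not> (pulls A a t \<omega> = n \<and> good \<epsilon> n0 b t \<omega>)) sequentially"
    unfolding AE_all_countable using AE_not_stuck[OF ab \<epsilon>(1,2) b(1) \<epsilon>(3) n0] by blast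
  moreover have "AE \<omega> in M. \<exists>n1. \<forall>t\<ge>1. n1 \<le> pulls A b t \<omega> \<longrightarrow>
    \<bar>real (successes A R b t \<omega>) - \<mu> b * real (pulls A b t \<omega>)\<bar> < \<epsilon> * real (pulls A b t \<omega>)"
    using b \<epsilon> by (intro AE_empirical_mean) auto
  ultimately show ?thesis
    using AE_space
  proof eventually_elim
    case (elim \<omega>)
    show ?case
    proof (rule ccontr)
      assume "\<not> ?thesis"
      then obtain n where n: "\<And>t. t \<ge> 1 \<Longrightarrow> pulls A a t \<omega> \<le> n"
        by (auto simp: not_less)
      define m where "m = Max ((\<lambda>t. pulls A a t \<omega>) ` {1..})"
      have fin: "finite ((\<lambda>t. pulls A a t \<omega>) ` {1..})"
        by (rule finite_subset[of _ "{..n}"]) (use n in auto)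
      have "m \<in> (\<lambda>t. pulls A a t \<omega>) ` {1..}"
        unfolding m_def by (rule Max_in[OF fin]) auto
      then obtain t0 where t0: "t0 \<ge> 1" "pulls A a t0 \<omega> = m"
        by auto
      have const: "pulls A a t \<omega> = m" if "t \<ge> t0" for t
      proof (rule antisym)
        show "pulls A a t \<omega> \<le> m"
          unfolding m_def using that t0 by (intro Max_ge fin) auto
        show "m \<le> pulls A a t \<omega>"
          using pulls_mono[OF that, of A a \<omega>] t0 by simp
      qed
      obtain n1 where n1: "\<And>t. t \<ge> 1 \<Longrightarrow> n1 \<le> pulls A b t \<omega> \<Longrightarrow>
          \<bar>real (successes A R b t \<omega>) - \<mu> b * real (pulls A b t \<omega>)\<bar> < \<epsilon> * real (pulls A b t \<omega>)"
        using elim(2) by blast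
      obtain t1 where t1: "\<And>t. t \<ge> t1 \<Longrightarrow> \<not> (pulls A a t \<omega> = m \<and> good \<epsilon> n0 b t \<omega>)"
        using elim(1) unfolding eventually_sequentially by blast
      \<comment> \<open>Late enough for every threshold: with \<open>m\<close> pulls of arm
        \<open>a\<close>, arm \<open>b\<close> has \<open>t0 + t1 + n0 + n1\<close> pulls before
        this time.\<close>
      define t where "t = t0 + t1 + m + n0 + n1 + 1"
      have "pulls A a t \<omega> + pulls A b t \<omega> = t - 1"
        using pulls_add[OF elim(3), of t] ab by auto
      then have "pulls A b t \<omega> \<ge> n0" "pulls A b t \<omega> \<ge> n1"
        using const[of t] by (auto simp: t_def)
      then have "good \<epsilon> n0 b t \<omega>"
        using n1[of t] by (simp add: good_def t_def)
      then show False
        using t1[of t] const[of t] by (simp add: t_def)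
    qed
  qed
qed

section \<open>Suboptimal pulls are isolated\<close>

definition both_good :: "real \<Rightarrow> nat \<Rightarrow> nat \<Rightarrow> 'w set" where
  "both_good \<epsilon> n0 t = {\<omega> \<in> space M. good \<epsilon> n0 1 t \<omega> \<and> good \<epsilon> n0 2 t \<omega>}"

lemma both_good_hist: "s \<le> t \<Longrightarrow> both_good \<epsilon> n0 s \<in> sets (hist t)"
proof -
  assume "s \<le> t"
  note [measurable] = good_measurable[OF this]
  have "{\<omega> \<in> space (hist t). good \<epsilon> n0 1 s \<omega> \<and> good \<epsilon> n0 2 s \<omega>} \<in> sets (hist t)"
    by measurable
  then show ?thesis by (simp add: both_good_def)
qed

context
  fixes \<epsilon> :: real and n0 :: nat
  assumes \<epsilon>: "0 < \<epsilon>" "\<epsilon> \<le> 1" and gap: "\<mu> 1 - \<mu> 2 = 4 * \<epsilon>"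
    and n0: "\<And>n. n \<ge> n0 \<Longrightarrow> beta_tail \<epsilon> n \<le> 1 / 4"
begin

text \<open>If arm 2 is chosen, its sample lies above the midpoint or that of arm 1 lies below it,
  and on the good event each is a posterior tail. The weight \<open>f\<close> stands for
  conditioning on an event of the history.\<close>

lemma expectation_suboptimal_le:
  fixes f :: "'w \<Rightarrow> real"
  assumes t: "t \<ge> 1" and f: "f \<in> borel_measurable (hist t)"
    and bdd: "\<And>\<omega>. \<omega> \<in> space M \<Longrightarrow> 0 \<le> f \<omega> \<and> f \<omega> \<le> 1"
    and supp: "\<And>\<omega>. \<omega> \<in> space M \<Longrightarrow> f \<omega> \<noteq> 0 \<Longrightarrow> \<omega> \<in> both_good \<epsilon> n0 t"
  shows "expectation (\<lambda>\<omega>. f \<omega> * indicator {\<omega> \<in> space M. A t \<omega> = 2} \<omega>) \<le>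
    expectation (\<lambda>\<omega>. f \<omega> * (beta_tail \<epsilon> (pulls A 1 t \<omega>) + beta_tail \<epsilon> (pulls A 2 t \<omega>)))"
proof -
  \<comment> \<open>The midpoint of the means, equal to \<open>\<mu> 1 - 2 * \<epsilon>\<close> by
    \<open>gap\<close>, so \<open>posterior_tail\<close> applies on both sides.\<close>
  define m where "m = \<mu> 2 + 2 * \<epsilon>"
  let ?hi = "indicator {\<omega> \<in> space M. \<theta> t 2 \<omega> \<in> {m..}} :: 'w \<Rightarrow> real"
  let ?lo = "indicator {\<omega> \<in> space M. \<theta> t 1 \<omega> \<in> {..m}} :: 'w \<Rightarrow> real"
  let ?two = "indicator {\<omega> \<in> space M. A t \<omega> = 2} :: 'w \<Rightarrow> real"
  have [measurable]: "\<theta> t 1 \<in> borel_measurable M" "\<theta> t 2 \<in> borel_measurable M"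
    using sample_measurable[OF t] by auto
  note [measurable] = measurable_hist[OF f] measurable_hist[OF posterior_measurable]
    pulls_measurable_hist[OF order_refl, THEN measurable_hist] arm_measurable[OF t]
  have abs_f: "\<bar>f \<omega>\<bar> \<le> 1" if "\<omega> \<in> space M" for \<omega>
    using bdd[OF that] by simp
  have ind_int: "integrable M (\<lambda>\<omega>. f \<omega> * indicator X \<omega>)" if "X \<in> sets M" for X
    by (rule integrable_times_bounded[OF _ _ abs_f]) (use that in \<open>auto simp: indicator_def\<close>)
  have sets: "{\<omega> \<in> space M. \<theta> t 2 \<omega> \<in> {m..}} \<in> sets M" "{\<omega> \<in> space M. \<theta> t 1 \<omega> \<in> {..m}} \<in> sets M"
    "{\<omega> \<in> space M. A t \<omega> = 2} \<in> sets M"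
    by measurable
  have post_int: "integrable M (\<lambda>\<omega>. f \<omega> * measure (posterior t a \<omega>) X)" for a X
    by (rule integrable_times_bounded[OF _ _ abs_f])
      (use posterior_le_1 measurable_hist[OF posterior_measurable] measurable_hist[OF f] in simp_all)
  have tail_int: "integrable M (\<lambda>\<omega>. f \<omega> * beta_tail \<epsilon> (pulls A a t \<omega>))" for a
  proof -
    have "integrable M (\<lambda>\<omega>. beta_tail \<epsilon> (pulls A a t \<omega>) * f \<omega>)"
    proof (rule integrable_times_bounded)
      show "\<bar>beta_tail \<epsilon> (pulls A a t \<omega>)\<bar> \<le> beta_tail \<epsilon> 0" for \<omega>
        using beta_tail_nonneg[of \<epsilon> "pulls A a t \<omega>"] beta_tail_antimono[of 0 "pulls A a t \<omega>" \<epsilon>] by simp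
      show "(\<lambda>\<omega>. beta_tail \<epsilon> (pulls A a t \<omega>)) \<in> borel_measurable M"
        by measurable
    qed (use abs_f measurable_hist[OF f] in simp_all)
    then show ?thesis by (simp add: mult.commute)
  qed
  have "expectation (\<lambda>\<omega>. f \<omega> * ?two \<omega>) \<le> expectation (\<lambda>\<omega>. f \<omega> * ?hi \<omega> + f \<omega> * ?lo \<omega>)"
  proof (intro integral_mono Bochner_Integration.integrable_add ind_int sets)
    fix \<omega> assume \<omega>: "\<omega> \<in> space M"
    have "?two \<omega> \<le> ?hi \<omega> + ?lo \<omega>"
    proof (cases "A t \<omega> = 2")
      case True
      then have "\<theta> t 1 \<omega> \<le> \<theta> t 2 \<omega>"
        using arm_choice[OF t \<omega>] by (auto simp: is_arg_max_def)
      then have "m \<le> \<theta> t 2 \<omega> \<or> \<theta> t 1 \<omega> \<le> m"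
        by linarith
      then show ?thesis using \<omega> by (auto simp: indicator_def)
    qed simp
    then have "f \<omega> * ?two \<omega> \<le> f \<omega> * (?hi \<omega> + ?lo \<omega>)"
      using bdd[OF \<omega>] by (intro mult_left_mono) auto
    then show "f \<omega> * ?two \<omega> \<le> f \<omega> * ?hi \<omega> + f \<omega> * ?lo \<omega>"
      by (simp only: distrib_left)
  qed
  also have "\<dots> = expectation (\<lambda>\<omega>. f \<omega> * ?hi \<omega>) + expectation (\<lambda>\<omega>. f \<omega> * ?lo \<omega>)"
    by (intro Bochner_Integration.integral_add ind_int sets)
  also have "expectation (\<lambda>\<omega>. f \<omega> * ?hi \<omega>) = expectation (\<lambda>\<omega>. f \<omega> * measure (posterior t 2 \<omega>) {m..})"
    by (rule integral_sample[OF t f abs_f]) auto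
  also have "expectation (\<lambda>\<omega>. f \<omega> * ?lo \<omega>) = expectation (\<lambda>\<omega>. f \<omega> * measure (posterior t 1 \<omega>) {..m})"
    by (rule integral_sample[OF t f abs_f]) auto
  also have "expectation (\<lambda>\<omega>. f \<omega> * measure (posterior t 2 \<omega>) {m..}) +
      expectation (\<lambda>\<omega>. f \<omega> * measure (posterior t 1 \<omega>) {..m}) \<le>
      expectation (\<lambda>\<omega>. f \<omega> * beta_tail \<epsilon> (pulls A 2 t \<omega>)) +
      expectation (\<lambda>\<omega>. f \<omega> * beta_tail \<epsilon> (pulls A 1 t \<omega>))"
  proof (intro add_mono integral_mono post_int tail_int)
    fix \<omega> assume \<omega>: "\<omega> \<in> space M"
    show "f \<omega> * measure (posterior t 2 \<omega>) {m..} \<le> f \<omega> * beta_tail \<epsilon> (pulls A 2 t \<omega>)"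
    proof (cases "f \<omega> = 0")
      case False
      then show ?thesis
        using supp[OF \<omega>] bdd[OF \<omega>] \<epsilon> \<omega>
        by (intro mult_left_mono posterior_tail) (auto simp: both_good_def m_def)
    qed simp
    show "f \<omega> * measure (posterior t 1 \<omega>) {..m} \<le> f \<omega> * beta_tail \<epsilon> (pulls A 1 t \<omega>)"
    proof (cases "f \<omega> = 0")
      case False
      then show ?thesis
        using supp[OF \<omega>] bdd[OF \<omega>] \<epsilon> \<omega> gap
        by (intro mult_left_mono posterior_tail) (auto simp: both_good_def m_def)
    qed simp
  qed
  also have "\<dots> = expectation (\<lambda>\<omega>. f \<omega> * (beta_tail \<epsilon> (pulls A 1 t \<omega>) + beta_tail \<epsilon> (pulls A 2 t \<omega>)))"
    using tail_int by (simp add: distrib_left)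
  finally show ?thesis .
qed

text \<open>On the good event each tail is at most 1/4, so arm 2 receives at most half of the weight
  and arm 1 the rest.\<close>

lemma expectation_suboptimal_le_optimal:
  fixes f :: "'w \<Rightarrow> real"
  assumes t: "t \<ge> 1" and f: "f \<in> borel_measurable (hist t)"
    and bdd: "\<And>\<omega>. \<omega> \<in> space M \<Longrightarrow> 0 \<le> f \<omega> \<and> f \<omega> \<le> 1"
    and supp: "\<And>\<omega>. \<omega> \<in> space M \<Longrightarrow> f \<omega> \<noteq> 0 \<Longrightarrow> \<omega> \<in> both_good \<epsilon> n0 t"
  shows "expectation (\<lambda>\<omega>. f \<omega> * indicator {\<omega> \<in> space M. A t \<omega> = 2} \<omega>) \<le>
    expectation (\<lambda>\<omega>. f \<omega> * indicator {\<omega> \<in> space M. A t \<omega> = 1} \<omega>)"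
proof -
  let ?I = "\<lambda>a. indicator {\<omega> \<in> space M. A t \<omega> = a} :: 'w \<Rightarrow> real"
  note [measurable] = measurable_hist[OF f] arm_measurable[OF t]
    pulls_measurable_hist[OF order_refl, THEN measurable_hist]
  have abs_f: "\<bar>f \<omega>\<bar> \<le> 1" if "\<omega> \<in> space M" for \<omega>
    using bdd[OF that] by simp
  have I_int: "integrable M (\<lambda>\<omega>. f \<omega> * ?I a \<omega>)" for a
  proof (rule integrable_times_bounded[OF _ _ abs_f])
    show "?I a \<in> borel_measurable M" by measurable
  qed (use measurable_hist[OF f] in \<open>auto simp: indicator_def\<close>)
  have f_int: "integrable M f"
    using integrable_times_bounded[of f "\<lambda>_. 1" 1] abs_f measurable_hist[OF f] by simp
  have tail_le: "f \<omega> * (beta_tail \<epsilon> (pulls A 1 t \<omega>) + beta_tail \<epsilon> (pulls A 2 t \<omega>)) \<le> f \<omega> * (1 / 2)"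
    if \<omega>: "\<omega> \<in> space M" for \<omega>
  proof (cases "f \<omega> = 0")
    case False
    then have "beta_tail \<epsilon> (pulls A 1 t \<omega>) \<le> 1 / 4" "beta_tail \<epsilon> (pulls A 2 t \<omega>) \<le> 1 / 4"
      using supp[OF \<omega>] by (simp_all only: n0 both_good_def good_def mem_Collect_eq not_False_eq_True)
    then show ?thesis
      using bdd[OF \<omega>] by (intro mult_left_mono) auto
  qed simp
  have "expectation (\<lambda>\<omega>. f \<omega> * ?I 2 \<omega>) \<le>
      expectation (\<lambda>\<omega>. f \<omega> * (beta_tail \<epsilon> (pulls A 1 t \<omega>) + beta_tail \<epsilon> (pulls A 2 t \<omega>)))"
    by (rule expectation_suboptimal_le[OF t f bdd supp])
  also have "\<dots> \<le> expectation (\<lambda>\<omega>. f \<omega> * (1 / 2))"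
  proof (rule integral_mono')
    show "integrable M (\<lambda>\<omega>. f \<omega> * (1 / 2))"
      using f_int by simp
    show "0 \<le> f \<omega> * (1 / 2)" if "\<omega> \<in> space M" for \<omega>
      using bdd[OF that] by simp
  qed (rule tail_le)
  also have "\<dots> = expectation f / 2"
    by simp
  finally have "2 * expectation (\<lambda>\<omega>. f \<omega> * ?I 2 \<omega>) \<le> expectation f"
    by simp
  also have "expectation f = expectation (\<lambda>\<omega>. f \<omega> * ?I 1 \<omega> + f \<omega> * ?I 2 \<omega>)"
  proof (rule Bochner_Integration.integral_cong[OF refl])
    fix \<omega> assume "\<omega> \<in> space M"
    then show "f \<omega> = f \<omega> * ?I 1 \<omega> + f \<omega> * ?I 2 \<omega>"
      using arm_cases[OF t, of \<omega>] by auto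
  qed
  also have "\<dots> = expectation (\<lambda>\<omega>. f \<omega> * ?I 1 \<omega>) + expectation (\<lambda>\<omega>. f \<omega> * ?I 2 \<omega>)"
    by (intro Bochner_Integration.integral_add I_int)
  finally show ?thesis by simp
qed

text \<open>
  The bound has to be summable over \<open>s\<close>, which needs each tail to go with a pull of the same arm.
  The tail of arm 1 first comes with a pull of arm 2, and is transferred to a pull of arm 1 because
  that one is the more likely choice on the good event.
\<close>

lemma prob_two_suboptimal_le:
  assumes s: "1 \<le> s" "s < t"
  shows "prob {\<omega> \<in> space M. A s \<omega> = 2 \<and> A t \<omega> = 2 \<and> \<omega> \<in> both_good \<epsilon> n0 s \<and> \<omega> \<in> both_good \<epsilon> n0 t} \<le>
    expectation (\<lambda>\<omega>. beta_tail \<epsilon> (pulls A 1 s \<omega>) * indicator {\<omega> \<in> space M. A s \<omega> = 1} \<omega>) +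
    expectation (\<lambda>\<omega>. beta_tail \<epsilon> (pulls A 2 s \<omega>) * indicator {\<omega> \<in> space M. A s \<omega> = 2} \<omega>)"
proof -
  define b where "b = beta_tail \<epsilon>"
  define C where "C = b 0"
  have b: "0 \<le> b n" "b n \<le> C" "\<bar>b n\<bar> \<le> C" for n
    using beta_tail_nonneg[of \<epsilon>] beta_tail_antimono[of 0 _ \<epsilon>] by (auto simp: b_def C_def)
  have C: "C > 0"
    using \<epsilon> by (simp add: C_def b_def beta_tail_def)
  have t: "t \<ge> 1" using s by simp
  let ?I = "\<lambda>a. indicator {\<omega> \<in> space M. A s \<omega> = a} :: 'w \<Rightarrow> real"
  let ?G = "indicator (both_good \<epsilon> n0 s) :: 'w \<Rightarrow> real"
  let ?X = "{\<omega> \<in> space M. A s \<omega> = 2} \<inter> both_good \<epsilon> n0 s \<inter> both_good \<epsilon> n0 t"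
  let ?f = "indicator ?X :: 'w \<Rightarrow> real"
  \<comment> \<open>Division by \<open>C\<close>, the largest value of \<open>b\<close>, brings the
    weight into the unit interval, as \<open>expectation_suboptimal_le_optimal\<close>
    requires.\<close>
  let ?g = "\<lambda>\<omega>. ?G \<omega> * b (pulls A 1 s \<omega>) / C"
  have As: "{\<omega> \<in> space M. A s \<omega> = a} \<in> sets (hist t)" for a
  proof -
    note [measurable] = arm_measurable_hist[OF s]
    have "{\<omega> \<in> space (hist t). A s \<omega> = a} \<in> sets (hist t)" by measurable
    then show ?thesis by simp
  qed
  \<comment> \<open>Because \<open>s < t\<close>, the first pull is part of the history before
    \<open>t\<close> and can serve as a weight for the choice at \<open>t\<close>.\<close>
  have X: "?X \<in> sets (hist t)"
    using s both_good_hist[of s t] both_good_hist[of t t] As by auto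
  have f: "?f \<in> borel_measurable (hist t)"
    using X by simp
  have g: "?g \<in> borel_measurable (hist s)"
  proof -
    note [measurable] = both_good_hist[of s s, simplified] pulls_measurable_hist[of s s, simplified]
    show ?thesis by measurable
  qed
  note [measurable] = sets_hist[OF X] sets_hist[OF both_good_hist[OF order_refl]] sets_hist[OF As]
    arm_measurable[OF t] arm_measurable[OF s(1)] pulls_measurable_hist[OF order_refl, THEN measurable_hist]
  have I_int: "integrable M (\<lambda>\<omega>. b (pulls A c s \<omega>) * ?I a \<omega>)" for a c
  proof (rule integrable_times_bounded)
    show "(\<lambda>\<omega>. b (pulls A c s \<omega>)) \<in> borel_measurable M" "?I a \<in> borel_measurable M"
      by measurable
    show "\<bar>b (pulls A c s \<omega>)\<bar> \<le> C" "\<bar>?I a \<omega>\<bar> \<le> 1" for \<omega>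
      using b by (auto simp: indicator_def)
  qed
  have GI_int: "integrable M (\<lambda>\<omega>. ?G \<omega> * (b (pulls A c s \<omega>) * ?I a \<omega>))" for a c
    using integrable_real_mult_indicator[OF sets_hist[OF both_good_hist[OF order_refl]] I_int]
    by (simp add: mult.commute)
  have "prob {\<omega> \<in> space M. A s \<omega> = 2 \<and> A t \<omega> = 2 \<and> \<omega> \<in> both_good \<epsilon> n0 s \<and> \<omega> \<in> both_good \<epsilon> n0 t} =
      expectation (indicator (?X \<inter> {\<omega> \<in> space M. A t \<omega> = 2}))"
  proof -
    have "{\<omega> \<in> space M. A s \<omega> = 2 \<and> A t \<omega> = 2 \<and> \<omega> \<in> both_good \<epsilon> n0 s \<and> \<omega> \<in> both_good \<epsilon> n0 t} =
        ?X \<inter> {\<omega> \<in> space M. A t \<omega> = 2}"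
      by auto
    moreover have "?X \<inter> {\<omega> \<in> space M. A t \<omega> = 2} \<subseteq> space M"
      by auto
    ultimately show ?thesis by (simp add: Int_absorb2)
  qed
  also have "\<dots> = expectation (\<lambda>\<omega>. ?f \<omega> * indicator {\<omega> \<in> space M. A t \<omega> = 2} \<omega>)"
    by (intro Bochner_Integration.integral_cong refl indicator_inter_arith)
  also have "\<dots> \<le> expectation (\<lambda>\<omega>. ?f \<omega> * (b (pulls A 1 t \<omega>) + b (pulls A 2 t \<omega>)))"
    unfolding b_def by (rule expectation_suboptimal_le[OF t f]) (auto simp: indicator_def split: if_splits)
  \<comment> \<open>Counters only grow and \<open>b\<close> decreases, so the tails at
    \<open>t\<close> are bounded by those at \<open>s\<close>. The factor \<open>?G\<close> is kept
    for the tail of arm 1, whose transfer to a pull of arm 1 needs the good event at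
    \<open>s\<close>.\<close>
  also have "\<dots> \<le> expectation (\<lambda>\<omega>. ?G \<omega> * (b (pulls A 1 s \<omega>) * ?I 2 \<omega>) + b (pulls A 2 s \<omega>) * ?I 2 \<omega>)"
  proof (rule integral_mono')
    show "integrable M (\<lambda>\<omega>. ?G \<omega> * (b (pulls A 1 s \<omega>) * ?I 2 \<omega>) + b (pulls A 2 s \<omega>) * ?I 2 \<omega>)"
      by (intro Bochner_Integration.integrable_add GI_int I_int)
    fix \<omega> assume \<omega>: "\<omega> \<in> space M"
    show "0 \<le> ?G \<omega> * (b (pulls A 1 s \<omega>) * ?I 2 \<omega>) + b (pulls A 2 s \<omega>) * ?I 2 \<omega>"
      using b(1) by simp
    have "b (pulls A a t \<omega>) \<le> b (pulls A a s \<omega>)" for a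
      unfolding b_def using s by (intro beta_tail_antimono pulls_mono) simp
    from this[of 1] this[of 2]
    show "?f \<omega> * (b (pulls A 1 t \<omega>) + b (pulls A 2 t \<omega>)) \<le>
        ?G \<omega> * (b (pulls A 1 s \<omega>) * ?I 2 \<omega>) + b (pulls A 2 s \<omega>) * ?I 2 \<omega>"
      using b(1) \<omega> by (cases "\<omega> \<in> ?X") (auto simp: add_mono)
  qed
  also have "\<dots> = expectation (\<lambda>\<omega>. ?G \<omega> * (b (pulls A 1 s \<omega>) * ?I 2 \<omega>)) + expectation (\<lambda>\<omega>. b (pulls A 2 s \<omega>) * ?I 2 \<omega>)"
    by (intro Bochner_Integration.integral_add GI_int I_int)
  also have "expectation (\<lambda>\<omega>. ?G \<omega> * (b (pulls A 1 s \<omega>) * ?I 2 \<omega>)) \<le>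
      expectation (\<lambda>\<omega>. ?G \<omega> * (b (pulls A 1 s \<omega>) * ?I 1 \<omega>))"
  proof -
    have "expectation (\<lambda>\<omega>. ?g \<omega> * ?I 2 \<omega>) \<le> expectation (\<lambda>\<omega>. ?g \<omega> * ?I 1 \<omega>)"
      by (rule expectation_suboptimal_le_optimal[OF s(1) g])
        (use b C in \<open>auto simp: indicator_def split: if_splits\<close>)
    moreover have "expectation (\<lambda>\<omega>. ?g \<omega> * ?I a \<omega>) =
        expectation (\<lambda>\<omega>. ?G \<omega> * (b (pulls A 1 s \<omega>) * ?I a \<omega>)) / C" for a
    proof -
      have "(\<lambda>\<omega>. ?g \<omega> * ?I a \<omega>) = (\<lambda>\<omega>. ?G \<omega> * (b (pulls A 1 s \<omega>) * ?I a \<omega>) / C)"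
        by (simp add: mult_ac)
      then show ?thesis by simp
    qed
    ultimately show ?thesis
      using C by (simp add: divide_le_cancel)
  qed
  also have "\<dots> \<le> expectation (\<lambda>\<omega>. b (pulls A 1 s \<omega>) * ?I 1 \<omega>)"
  proof (intro integral_mono GI_int I_int)
    show "?G \<omega> * (b (pulls A 1 s \<omega>) * ?I 1 \<omega>) \<le> b (pulls A 1 s \<omega>) * ?I 1 \<omega>" for \<omega>
      using b(1)[of "pulls A 1 s \<omega>"] by (simp add: indicator_def)
  qed
  finally show ?thesis
    by (simp add: b_def)
qed

text \<open>The estimate for a pair does not involve the distance \<open>k\<close>; summed over the
  first round it gives one convergent tail series per arm.\<close>

lemma AE_not_two_suboptimal:
  assumes k: "k \<ge> 1"
  shows "AE \<omega> in M. eventually (\<lambda>t. \<not> (A t \<omega> = 2 \<and> A (t + k) \<omega> = 2 \<and>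
    \<omega> \<in> both_good \<epsilon> n0 t \<and> \<omega> \<in> both_good \<epsilon> n0 (t + k))) sequentially"
proof (rule AE_eventually_not)
  fix t :: nat assume t: "t \<ge> 1"
  have "A t \<in> M \<rightarrow>\<^sub>M count_space UNIV" "A (t + k) \<in> M \<rightarrow>\<^sub>M count_space UNIV"
    using t by (auto intro!: arm_measurable)
  note [measurable] = this sets_hist[OF both_good_hist[OF order_refl]]
  show "{\<omega> \<in> space M. A t \<omega> = 2 \<and> A (t + k) \<omega> = 2 \<and> \<omega> \<in> both_good \<epsilon> n0 t \<and> \<omega> \<in> both_good \<epsilon> n0 (t + k)} \<in> events"
    by measurable
next
  fix K
  let ?E = "\<lambda>a t. expectation (\<lambda>\<omega>. beta_tail \<epsilon> (pulls A a t \<omega>) * indicator {\<omega> \<in> space M. A t \<omega> = a} \<omega>)"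
  have "(\<Sum>t = 1..<K. prob {\<omega> \<in> space M. A t \<omega> = 2 \<and> A (t + k) \<omega> = 2 \<and>
      \<omega> \<in> both_good \<epsilon> n0 t \<and> \<omega> \<in> both_good \<epsilon> n0 (t + k)}) \<le> (\<Sum>t = 1..<K. ?E 1 t + ?E 2 t)"
    using k by (intro sum_mono prob_two_suboptimal_le) auto
  also have "\<dots> = (\<Sum>t = 1..<K. ?E 1 t) + (\<Sum>t = 1..<K. ?E 2 t)"
    by (rule sum.distrib)
  also have "\<dots> \<le> suminf (beta_tail \<epsilon>) + suminf (beta_tail \<epsilon>)"
    using \<epsilon> by (intro add_mono pulls_expectation_sum_le beta_tail_nonneg summable_beta_tail) auto
  finally show "(\<Sum>t = 1..<K. prob {\<omega> \<in> space M. A t \<omega> = 2 \<and> A (t + k) \<omega> = 2 \<and>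
      \<omega> \<in> both_good \<epsilon> n0 t \<and> \<omega> \<in> both_good \<epsilon> n0 (t + k)}) \<le> suminf (beta_tail \<epsilon>) + suminf (beta_tail \<epsilon>)" .
qed

end

section \<open>Almost sure recurrence and isolation of the suboptimal pulls\<close>

lemma AE_eventually_good:
  assumes ab: "a \<in> {1, 2}" "b \<in> {1, 2}" "a \<noteq> b" and b: "0 \<le> \<mu> b" "\<mu> b < 1"
    and a: "0 \<le> \<mu> a" "\<mu> a \<le> 1" and \<epsilon>: "\<epsilon> > 0"
  shows "AE \<omega> in M. eventually (\<lambda>t. good \<epsilon> n0 a t \<omega>) sequentially"
  using AE_pulls_unbounded[OF ab b] AE_empirical_mean[OF a \<epsilon>]
proof eventually_elim
  case (elim \<omega>)
  obtain n1 where n1: "\<And>t. t \<ge> 1 \<Longrightarrow> n1 \<le> pulls A a t \<omega> \<Longrightarrow>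
      \<bar>real (successes A R a t \<omega>) - \<mu> a * real (pulls A a t \<omega>)\<bar> < \<epsilon> * real (pulls A a t \<omega>)"
    using elim(2) by blast
  obtain t0 where t0: "t0 \<ge> 1" "n0 + n1 < pulls A a t0 \<omega>"
    using elim(1) by blast
  show ?case
    unfolding eventually_sequentially
  proof (intro exI allI impI)
    fix t assume t: "t0 \<le> t"
    have "n0 + n1 < pulls A a t \<omega>"
      using t0 pulls_mono[OF t, of A a \<omega>] by simp
    then show "good \<epsilon> n0 a t \<omega>"
      using n1[of t] t0 t by (simp add: good_def)
  qed
qed

lemma AE_suboptimal_infinitely_often:
  assumes "0 \<le> \<mu> 1" "\<mu> 1 < 1"
  shows "AE \<omega> in M. \<forall>t. \<exists>s\<ge>t. A s \<omega> = 2"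
proof -
  have "AE \<omega> in M. \<forall>n. \<exists>t\<ge>1. n < pulls A 2 t \<omega>"
    by (rule AE_pulls_unbounded[of 2 1]) (use assms in auto)
  then show ?thesis
  proof eventually_elim
    case (elim \<omega>)
    show ?case
    proof (rule ccontr)
      assume "\<not> ?thesis"
      then obtain t where t: "\<And>s. s \<ge> t \<Longrightarrow> A s \<omega> \<noteq> 2"
        by blast
      have "pulls A 2 s \<omega> \<le> t" for s
      proof -
        have "pulls A 2 s \<omega> = (\<Sum>i\<in>{1..<s} \<inter> {..<t}. if A i \<omega> = 2 then 1 else 0)"
          unfolding pulls_def using t by (intro sum.mono_neutral_right) (auto simp: not_less[symmetric])
        also have "\<dots> \<le> (\<Sum>i\<in>{1..<s} \<inter> {..<t}. 1)"
          by (intro sum_mono) auto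
        also have "\<dots> \<le> card {..<t}"
          by (simp add: card_mono del: card_lessThan)
        finally show ?thesis by simp
      qed
      then show False
        using elim[rule_format, of t] by (auto simp: not_less[symmetric])
    qed
  qed
qed

lemma AE_suboptimal_isolated:
  assumes \<mu>: "0 < \<mu> 2" "\<mu> 2 < \<mu> 1" "\<mu> 1 < 1"
  shows "AE \<omega> in M. \<forall>k\<ge>1. eventually (\<lambda>t. \<not> (A t \<omega> = 2 \<and> A (t + k) \<omega> = 2)) sequentially"
proof -
  define \<epsilon> where "\<epsilon> = (\<mu> 1 - \<mu> 2) / 4"
  have \<epsilon>: "0 < \<epsilon>" "\<epsilon> \<le> 1" "\<mu> 1 - \<mu> 2 = 4 * \<epsilon>"
    using \<mu> by (auto simp: \<epsilon>_def)
  obtain n0 where n0: "\<And>n. n \<ge> n0 \<Longrightarrow> beta_tail \<epsilon> n \<le> 1 / 4"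
    using ex_beta_tail_le[of \<epsilon> "1 / 4"] \<epsilon> by auto
  have "AE \<omega> in M. eventually (\<lambda>t. good \<epsilon> n0 1 t \<omega>) sequentially"
    by (rule AE_eventually_good[of 1 2]) (use \<mu> \<epsilon> in auto)
  moreover have "AE \<omega> in M. eventually (\<lambda>t. good \<epsilon> n0 2 t \<omega>) sequentially"
    by (rule AE_eventually_good[of 2 1]) (use \<mu> \<epsilon> in auto)
  \<comment> \<open>There are only countably many distances \<open>k\<close>, so one null set serves
    for all of them.\<close>
  moreover have "AE \<omega> in M. \<forall>k\<in>{1..}. eventually (\<lambda>t. \<not> (A t \<omega> = 2 \<and> A (t + k) \<omega> = 2 \<and>
      \<omega> \<in> both_good \<epsilon> n0 t \<and> \<omega> \<in> both_good \<epsilon> n0 (t + k))) sequentially"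
    using AE_not_two_suboptimal[OF \<epsilon> n0] by (subst AE_ball_countable) auto
  ultimately show ?thesis
    using AE_space
  proof eventually_elim
    case (elim \<omega>)
    have good: "eventually (\<lambda>t. \<omega> \<in> both_good \<epsilon> n0 t) sequentially"
      using elim(1,2) by eventually_elim (use elim(4) in \<open>simp add: both_good_def\<close>)
    show ?case
    proof (intro allI impI)
      fix k :: nat assume "k \<ge> 1"
      then have "eventually (\<lambda>t. \<not> (A t \<omega> = 2 \<and> A (t + k) \<omega> = 2 \<and>
          \<omega> \<in> both_good \<epsilon> n0 t \<and> \<omega> \<in> both_good \<epsilon> n0 (t + k))) sequentially"
        using elim(3) by auto
      moreover have "eventually (\<lambda>t. \<omega> \<in> both_good \<epsilon> n0 (t + k)) sequentially"
        using good by (rule sequentially_offset)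
      ultimately show "eventually (\<lambda>t. \<not> (A t \<omega> = 2 \<and> A (t + k) \<omega> = 2)) sequentially"
        using good by eventually_elim auto
    qed
  qed
qed

end

section \<open>The sliding regret of a single path with recurrent, isolated suboptimal pulls\<close>

lemma sliding_regret_eq_gap:
  fixes A :: "nat \<Rightarrow> 'w \<Rightarrow> nat"
  assumes arms: "\<And>t. t \<ge> 1 \<Longrightarrow> A t \<omega> = 1 \<or> A t \<omega> = 2"
    and gap: "\<mu> 2 < \<mu> 1" and T: "T \<ge> 1"
    and inf: "\<And>t. \<exists>s\<ge>t. A s \<omega> = 2"
    and iso: "\<And>k. k \<ge> 1 \<Longrightarrow> eventually (\<lambda>t. \<not> (A t \<omega> = 2 \<and> A (t + k) \<omega> = 2)) sequentially"
  shows "sliding_regret \<mu> A T \<omega> = ereal (\<mu> 1 - \<mu> 2)"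
proof -
  define X where "X t = real T * \<mu> 1 - (\<Sum>i = 1..T. \<mu> (A (t + i) \<omega>))" for t
  have X: "X t = (\<mu> 1 - \<mu> 2) * real (card {i\<in>{1..T}. A (t + i) \<omega> = 2})" for t
  proof -
    have "X t = (\<Sum>i = 1..T. \<mu> 1 - \<mu> (A (t + i) \<omega>))"
      by (simp add: X_def sum_subtractf)
    also have "\<dots> = (\<Sum>i = 1..T. if A (t + i) \<omega> = 2 then \<mu> 1 - \<mu> 2 else 0)"
    proof (intro sum.cong refl)
      fix i assume "i \<in> {1..T}"
      then show "\<mu> 1 - \<mu> (A (t + i) \<omega>) = (if A (t + i) \<omega> = 2 then \<mu> 1 - \<mu> 2 else 0)"
        using arms[of "t + i"] by auto
    qed
    also have "\<dots> = (\<Sum>i\<in>{i\<in>{1..T}. A (t + i) \<omega> = 2}. \<mu> 1 - \<mu> 2)"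
      by (rule sum.inter_filter[symmetric]) simp
    finally show ?thesis by simp
  qed
  \<comment> \<open>Two pulls in one window are less than \<open>T\<close> rounds apart, so finitely
    many distances matter and they share a starting time.\<close>
  have "eventually (\<lambda>t. \<forall>k\<in>{1..T}. \<not> (A t \<omega> = 2 \<and> A (t + k) \<omega> = 2)) sequentially"
    by (intro eventually_ball_finite) (use iso in auto)
  then obtain t0 where t0: "\<And>t k. t \<ge> t0 \<Longrightarrow> k \<in> {1..T} \<Longrightarrow> \<not> (A t \<omega> = 2 \<and> A (t + k) \<omega> = 2)"
    unfolding eventually_sequentially by blast
  have upper: "X t \<le> \<mu> 1 - \<mu> 2" if "t \<ge> t0" for t
  proof -
    have le: "j \<le> i" if ij: "i \<in> {1..T}" "j \<in> {1..T}" "A (t + i) \<omega> = 2" "A (t + j) \<omega> = 2" for i j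
    proof (rule ccontr)
      assume "\<not> j \<le> i"
      then have "j - i \<in> {1..T}" "t + i + (j - i) = t + j"
        using ij by auto
      then show False
        using t0[of "t + i" "j - i"] ij \<open>t \<ge> t0\<close> by simp
    qed
    have "card {i\<in>{1..T}. A (t + i) \<omega> = 2} \<le> Suc 0"
      by (subst card_le_Suc0_iff_eq) (auto intro!: antisym le)
    then have "(\<mu> 1 - \<mu> 2) * real (card {i\<in>{1..T}. A (t + i) \<omega> = 2}) \<le> (\<mu> 1 - \<mu> 2) * 1"
      using gap by (intro mult_left_mono) auto
    then show ?thesis by (simp add: X)
  qed
  \<comment> \<open>The window of \<open>X t\<close> starts at round \<open>t + 1\<close>, so a pull
    there is its first entry, present because \<open>T \<ge> 1\<close>.\<close>
  have lower: "\<mu> 1 - \<mu> 2 \<le> X t" if "A (Suc t) \<omega> = 2" for t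
  proof -
    have "card {i\<in>{1..T}. A (t + i) \<omega> = 2} > 0"
      using that T by (auto simp: card_gt_0_iff intro!: exI[of _ 1])
    then have "(\<mu> 1 - \<mu> 2) * 1 \<le> (\<mu> 1 - \<mu> 2) * real (card {i\<in>{1..T}. A (t + i) \<omega> = 2})"
      using gap by (intro mult_left_mono) auto
    then show ?thesis by (simp add: X)
  qed
  have "limsup (\<lambda>t. ereal (X t)) = ereal (\<mu> 1 - \<mu> 2)"
  proof (rule antisym)
    show "limsup (\<lambda>t. ereal (X t)) \<le> ereal (\<mu> 1 - \<mu> 2)"
      by (rule Limsup_bounded) (use upper in \<open>auto simp: eventually_sequentially\<close>)
    show "ereal (\<mu> 1 - \<mu> 2) \<le> limsup (\<lambda>t. ereal (X t))"
      unfolding limsup_INF_SUP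
    proof (rule INF_greatest)
      fix n
      \<comment> \<open>A pull in round \<open>s\<close> is seen by the window with index
        \<open>s - 1\<close>, which has to be at least \<open>n\<close>.\<close>
      obtain s where s: "s \<ge> Suc n" "A s \<omega> = 2"
        using inf by blast
      then have "ereal (\<mu> 1 - \<mu> 2) \<le> ereal (X (s - 1))"
        using lower[of "s - 1"] by simp
      also have "\<dots> \<le> (SUP m\<in>{n..}. ereal (X m))"
        using s by (intro SUP_upper) auto
      finally show "ereal (\<mu> 1 - \<mu> 2) \<le> (SUP m\<in>{n..}. ereal (X m))" .
    qed
  qed
  then show ?thesis
    by (simp add: sliding_regret_def X_def)
qed

theorem theorem4:
  fixes M :: "'w measure" and \<mu> :: "nat \<Rightarrow> real"
    and A R :: "nat \<Rightarrow> 'w \<Rightarrow> nat" and \<theta> :: "nat \<Rightarrow> nat \<Rightarrow> 'w \<Rightarrow> real" and T :: nat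
  assumes "thompson_sampling M \<mu> A R \<theta>"
    and "0 < \<mu> 2" and "\<mu> 2 < \<mu> 1" and "\<mu> 1 < 1"
    and "T \<ge> 1"
  shows "AE \<omega> in M. sliding_regret \<mu> A T \<omega> = ereal (\<mu> 1 - \<mu> 2)"
proof -
  interpret thompson_sampling M \<mu> A R \<theta>
    by fact
  have "AE \<omega> in M. \<forall>t. \<exists>s\<ge>t. A s \<omega> = 2"
    using assms by (intro AE_suboptimal_infinitely_often) auto
  then show ?thesis
    using AE_suboptimal_isolated[OF assms(2-4)] AE_space
  proof eventually_elim
    case (elim \<omega>)
    then show ?case
      using assms by (intro sliding_regret_eq_gap arm_cases) auto
  qed
qed

end
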